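(* Let $x_t$ be a solution of the SDE $dx_t=\frac1\varepsilon f(x_t,t)\,dt+\frac{\sigma}{\sqrt\varepsilon}\,dW_t$. Let $\delta>0$ be a constant such that $x\,\partial_{xx}f(x,t)\le0$ for $|x|\le\delta$ and $|t|\le T$, and let $c_1>0$ be a constant. For $0<\kappa<1$ let $$\mathcal D(\kappa)=\Bigl\{(x,t)\in[-\delta,\delta]\times[c_1\sqrt\sigma,T]:\ \frac{f(x,t)}x>\kappa a(t)\Bigr\}$$ and let $\tau_{\mathcal D(\kappa)}$ be the first exit time of $x_t$ from $\mathcal D(\kappa)$. Let $0<\kappa<1$ and assume $c_1^2\sigma\ge a_0\vee\varepsilon^{2/3}$. Then there exist constants $c_2\ge c_1$ and $C_0>0$ such that $$\mathbb P^{t_2,x_2}\{\tau_{\mathcal D(\kappa)}\ge t\}\le C_0\Bigl(\frac t{\sqrt\sigma}\Bigr)^2\frac{e^{-\kappa\alpha(t,t_2)/2\varepsilon}}{\sqrt{1-e^{-\kappa\alpha(t,t_2)/\varepsilon}}}$$ for all $(x_2,t_2)\in\mathcal D(\kappa)$ with $t_2\ge c_2\sqrt\sigma$ and all $t\in(t_2,T]$, where $\alpha(t,s)=\int_s^ta(u)\,du$.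
   Context: Conventions. $\varepsilon>0$ is a small parameter, and all assertions are for sufficiently small $\varepsilon$. $a_0=a_0(\varepsilon)>0$ with $a_0\to0$ as $\varepsilon\to0$, and $\sigma=\sigma(\varepsilon)>0$. Constants do not depend on $\varepsilon,a_0,\sigma,t,t_2,x_2$. $\vee,\wedge$ denote maximum and minimum. For $\varphi\ge 0$, $\psi\asymp\varphi$ means $c_-\varphi\le\psi\le c_+\varphi$ with constants $c_\pm>0$ independent of $t,\varepsilon$ (hence of $a_0,\sigma$); $\psi\asymp-\varphi$ means $-\psi\asymp\varphi$. $\mathcal O(u)$ denotes a quantity bounded by $K|u|$ for small $u$, with $K$ independent of $\varepsilon,a_0,\sigma$. Symmetric setting. $f:\mathbb R^2\to\mathbb R$ may depend on $\varepsilon$ through $a_0$ only, with all constants and derivative bounds below independent of $\varepsilon$. With $d>0$ a constant and $\mathcal M=[-d,d]\times\mathbb R$: $f\in\mathcal C^4(\mathcal M,\mathbb R)$; $f(x,t+1)=f(x,t)$ and $f(x,t)=-f(-x,t)$ on $\mathcal M$; there is a continuous $x^\star:\mathbb R\to(0,d]$ such that in $\mathcal M$, $f(x,t)=0$ iff $x=0$ or $x=\pm x^\star(t)$; for all $t$, $a(t):=\partial_xf(0,t)>0$ and $a^\star(t):=\partial_xf(x^\star(t),t)<0$; $\partial_{xxx}f(0,0)<0$ and $a(t)=a_0+a_1t^2+\mathcal O(t^3)$ near $t=0$, where $a_1>0$ and $\partial_{xxx}f(0,0)$ are fixed. Then $x^\star$ has a quadratic minimum at a time $t^\star=\mathcal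 O(a_0)$. $T\in(0,1/2)$ is a constant such that the derivatives of $a$ and $x^\star$ vanish only once in $[-T,T]$, and $x^\star,a,a^\star$ are bounded away from zero on $[T,1-T]$. Summary: $x^\star(t)\asymp\sqrt{a_0}$ and $a(t)\asymp a_0$ for $|t|\le\sqrt{a_0}$; $x^\star(t)\asymp|t|$ and $a(t)\asymp t^2$ for $\sqrt{a_0}\le|t|\le T$; $x^\star(t)\asymp1$ and $a(t)\asymp1$ for $T\le t\le1-T$; $a^\star(t)\asymp-a(t)$ for all $t$. SDE. $W$ is a standard Wiener process; $f$ satisfies the usual (local) Lipschitz and bounded-growth conditions guaranteeing a pathwise unique strong solution with continuous paths. $\mathbb P^{t_0,x_0}$ is the law of the solution started in $x_0$ at time $t_0$. The first exit time of $x_t$ from a space–time set is the first time $(x_t,t)$ is not in the set, and $\infty$ if there is no such time up to $T$. At $x=0$ the quotient $f(x,t)/x$ is read as its limit $a(t)$. *)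

theory Defs
  imports "HOL-Probability.Probability"
begin

text \<open>
  Partial derivatives of a function \<open>g x t\<close> on the closed strip \<open>[-d, d] \<times> \<real>\<close>. The derivative in
  \<open>x\<close> is taken relative to \<open>[-d, d]\<close>, so it is one-sided at \<open>x = \<plusminus>d\<close> and ignores the values of
  \<open>g\<close> outside the strip.
\<close>

definition partial_x :: "real \<Rightarrow> (real \<Rightarrow> real \<Rightarrow> real) \<Rightarrow> real \<Rightarrow> real \<Rightarrow> real" where
  "partial_x d g x t = vector_derivative (\<lambda>y. g y t) (at x within {-d..d})"

definition partial_t :: "(real \<Rightarrow> real \<Rightarrow> real) \<Rightarrow> real \<Rightarrow> real \<Rightarrow> real" where
  "partial_t g x t = vector_derivative (g x) (at t)"

text \<open>\<open>C_bounded n d B g\<close>: \<open>g\<close> is of class \<open>C\<^sup>n\<close> on \<open>[-d, d] \<times> \<real>\<close> and all its partial derivatives of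
  order at most \<open>n\<close> (including \<open>g\<close> itself) are bounded by \<open>B\<close> there.\<close>

fun C_bounded :: "nat \<Rightarrow> real \<Rightarrow> real \<Rightarrow> (real \<Rightarrow> real \<Rightarrow> real) \<Rightarrow> bool" where
  "C_bounded 0 d B g \<longleftrightarrow>
     continuous_on ({-d..d} \<times> UNIV) (\<lambda>(x, t). g x t) \<and> (\<forall>x\<in>{-d..d}. \<forall>t. \<bar>g x t\<bar> \<le> B)"
| "C_bounded (Suc n) d B g \<longleftrightarrow>
     C_bounded 0 d B g \<and>
     (\<forall>x\<in>{-d..d}. \<forall>t. (\<lambda>y. g y t) differentiable (at x within {-d..d}) \<and> g x differentiable (at t)) \<and>
     C_bounded n d B (partial_x d g) \<and> C_bounded n d B (partial_t g)"

text \<open>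
  One member of the family of drifts, with parameter \<open>a0\<close>. All the other parameters of the locale
  except \<open>f\<close> and \<open>xstar\<close> are constants: a family indexed by \<open>a0\<close> satisfies the locale assumptions
  with the same \<open>d, T, a1, b, B, K, r, m\<close>, which expresses uniformity in \<open>a0\<close>. Here \<open>b\<close> is the common
  value of \<open>\<partial>\<^sub>x\<^sub>x\<^sub>x f(0,0)\<close>, \<open>K\<close> and \<open>r\<close> are the constant and the range of validity of the error term
  \<open>O(t\<^sup>3)\<close>, and \<open>m\<close> is the bound away from zero on \<open>[T, 1 - T]\<close>.
\<close>

locale symmetric_drift =
  fixes d T a1 b B K r m a0 :: real
    and f :: "real \<Rightarrow> real \<Rightarrow> real"
    and xstar :: "real \<Rightarrow> real"
  assumes d_pos: "0 < d"
    and T_pos: "0 < T"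
    and T_less: "T < 1/2"
    and a1_pos: "0 < a1"
    and b_neg: "b < 0"
    and r_pos: "0 < r"
    and m_pos: "0 < m"
    and a0_pos: "0 < a0"
    and smooth: "C_bounded 4 d B f"
    and periodic: "x \<in> {-d..d} \<Longrightarrow> f x (t + 1) = f x t"
    and odd: "x \<in> {-d..d} \<Longrightarrow> f x t = - f (- x) t"
    and xstar_cont: "continuous_on UNIV xstar"
    and xstar_range: "xstar t \<in> {0<..d}"
    and zeros: "x \<in> {-d..d} \<Longrightarrow> f x t = 0 \<longleftrightarrow> x = 0 \<or> x = xstar t \<or> x = - xstar t"
    and a_pos: "0 < partial_x d f 0 t"
    and a_star_neg: "partial_x d f (xstar t) t < 0"
    and third_derivative: "(partial_x d ^^ 3) f 0 0 = b"
    and a_expansion: "\<bar>t\<bar> \<le> r \<Longrightarrow> \<bar>partial_x d f 0 t - (a0 + a1 * t\<^sup>2)\<bar> \<le> K * \<bar>t\<bar> ^ 3"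
    and a_critical: "\<exists>!t. t \<in> {-T..T} \<and> deriv (partial_x d f 0) t = 0"
    and xstar_critical: "\<exists>!t. t \<in> {-T..T} \<and> deriv xstar t = 0"
    and xstar_away: "t \<in> {T..1 - T} \<Longrightarrow> m \<le> xstar t"
    and a_away: "t \<in> {T..1 - T} \<Longrightarrow> m \<le> partial_x d f 0 t"
    and a_star_away: "t \<in> {T..1 - T} \<Longrightarrow> partial_x d f (xstar t) t \<le> - m"

text \<open>
  Local Lipschitz and growth conditions under which the equation with drift \<open>g\<close> and additive noise
  has a pathwise unique global strong solution. The growth condition is one-sided, which allows drifts
  such as \<open>x - x\<^sup>3\<close>; it is implied by linear growth.
\<close>

definition sde_conditions :: "(real \<Rightarrow> real \<Rightarrow> real) \<Rightarrow> bool" where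
  "sde_conditions g \<longleftrightarrow>
     (\<lambda>(x, t). g x t) \<in> borel_measurable borel \<and>
     (\<forall>R. \<exists>L. \<forall>t x y. \<bar>t\<bar> \<le> R \<longrightarrow> \<bar>x\<bar> \<le> R \<longrightarrow> \<bar>y\<bar> \<le> R \<longrightarrow> \<bar>g x t - g y t\<bar> \<le> L * \<bar>x - y\<bar>) \<and>
     (\<forall>R. \<exists>G. \<forall>t x. \<bar>t\<bar> \<le> R \<longrightarrow> x * g x t \<le> G * (1 + x\<^sup>2))"

definition wiener_process ::
    "'w measure \<Rightarrow> (real \<Rightarrow> 'w measure) \<Rightarrow> (real \<Rightarrow> 'w \<Rightarrow> real) \<Rightarrow> bool" where
  "wiener_process M F W \<longleftrightarrow>
     prob_space M \<and> filtration (space M) F \<and> (\<forall>t. subalgebra M (F t)) \<and>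
     (\<forall>t\<ge>0. W t \<in> borel_measurable (F t)) \<and>
     (AE \<omega> in M. W 0 \<omega> = 0) \<and>
     (AE \<omega> in M. continuous_on {0..} (\<lambda>t. W t \<omega>)) \<and>
     (\<forall>s t. 0 \<le> s \<longrightarrow> s < t \<longrightarrow>
        distributed M lborel (\<lambda>\<omega>. W t \<omega> - W s \<omega>) (normal_density 0 (sqrt (t - s))) \<and>
        prob_space.indep_set M (sets (F s))
          (sets (vimage_algebra (space M) (\<lambda>\<omega>. W t \<omega> - W s \<omega>) borel)))"

text \<open>
  \<open>X\<close> solves \<open>dX = g(X,t)/\<epsilon> dt + \<sigma>/\<surd>\<epsilon> dW\<close> on \<open>[t0, \<infinity>)\<close> with \<open>X(t0) = x0\<close>. Since the noise is additive,
  the stochastic integral is just an increment of \<open>W\<close>.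
\<close>

definition sde_solution ::
    "'w measure \<Rightarrow> (real \<Rightarrow> 'w measure) \<Rightarrow> (real \<Rightarrow> 'w \<Rightarrow> real) \<Rightarrow>
     (real \<Rightarrow> real \<Rightarrow> real) \<Rightarrow> real \<Rightarrow> real \<Rightarrow> real \<Rightarrow> real \<Rightarrow> (real \<Rightarrow> 'w \<Rightarrow> real) \<Rightarrow> bool" where
  "sde_solution M F W g \<epsilon> \<sigma> t0 x0 X \<longleftrightarrow>
     (\<forall>t\<ge>t0. X t \<in> borel_measurable (F t)) \<and>
     (\<forall>\<omega>\<in>space M. continuous_on {t0..} (\<lambda>t. X t \<omega>)) \<and>
     (AE \<omega> in M. \<forall>t\<ge>t0.
        set_integrable lborel {t0..t} (\<lambda>s. g (X s \<omega>) s) \<and>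
        X t \<omega> = x0 + (1 / \<epsilon>) * (LBINT s:{t0..t}. g (X s \<omega>) s) + \<sigma> / sqrt \<epsilon> * (W t \<omega> - W t0 \<omega>))"

text \<open>The infimum of the empty set is \<open>\<infinity>\<close> in \<^typ>\<open>ereal\<close>.\<close>

definition exit_time :: "(real \<times> real) set \<Rightarrow> real \<Rightarrow> real \<Rightarrow> (real \<Rightarrow> real) \<Rightarrow> ereal" where
  "exit_time D t0 T x = Inf (ereal ` {s \<in> {t0..T}. (x s, s) \<notin> D})"

text \<open>The set \<open>\<D>(\<kappa>)\<close> for a drift \<open>g\<close> on the strip \<open>[-d, d] \<times> \<real>\<close>, where \<open>a(t) = \<partial>\<^sub>x g(0,t)\<close>.\<close>

definition D_region ::
    "real \<Rightarrow> (real \<Rightarrow> real \<Rightarrow> real) \<Rightarrow> real \<Rightarrow> real \<Rightarrow> real \<Rightarrow> real \<Rightarrow> real \<Rightarrow> (real \<times> real) set" where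
  "D_region d g \<delta> T c1 \<sigma> \<kappa> =
     {(x, t). x \<in> {-\<delta>..\<delta>} \<and> t \<in> {c1 * sqrt \<sigma>..T} \<and>
        (if x = 0 then partial_x d g 0 t else g x t / x) > \<kappa> * partial_x d g 0 t}"

end

theory Submission
  imports Defs
begin

text \<open>
  Why the estimate holds. In the region the drift satisfies \<open>x f(x,t) \<ge> \<kappa> a(t) x\<^sup>2\<close>, so the solution is pushed
  away from \<open>0\<close> at least as strongly as the linear diffusion \<open>dY = \<kappa> a Y/\<epsilon> dt + \<sigma>/\<surd>\<epsilon> dW\<close>. The variable
  \<open>Y\<^sub>t\<close> is Gaussian with variance at least \<open>\<sigma>\<^sup>2 / (2 \<kappa> max a) (exp (2 \<kappa> \<alpha>/\<epsilon>) - 1)\<close>, while a path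
  that has not left the region by time \<open>t\<close> has \<open>\<bar>X\<^sub>t\<bar> \<le> H t\<close>, because the region has width of order \<open>t\<close>. A Gaussian variable of standard
  deviation \<open>s\<close> is in \<open>[-H t, H t]\<close> with probability at most of order \<open>t/s\<close>, and with \<open>a\<close> of order at
  most \<open>t\<^sup>2\<close> up to time \<open>t\<close> this gives the factor \<open>t\<^sup>2/\<sigma>\<close> and the exponential.

  The comparison is carried out with test functions rather than with a coupled process. For the
  linear diffusion, Gaussian densities are mapped to Gaussian densities by the backward equation, and
  since they decrease in \<open>\<bar>x\<bar>\<close> a stronger repulsion only decreases their expectation. So the expectation of a
  suitable Gaussian density of \<open>X\<^sub>s\<close>, restricted to the paths that are still in the region, decreases in time,
  and it does so at the exponential rate at which the linear diffusion spreads.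

  This monotonicity is proved in discrete time: averaging a Gaussian density over the
  independent Gaussian noise of one step is an exact convolution
  (\<open>expectation_normal_density_increment\<close>), and the variances of the test functions are chosen by a recursion
  that fits the Euler scheme exactly (\<open>gauss_euler_le\<close>, \<open>confined_gauss_Suc\<close>). The remaining error is the
  difference between the solution and one Euler step. Summed over all steps it tends to zero on almost
  every path by uniform continuity, and in expectation by dominated convergence
  (\<open>expected_euler_error_tendsto\<close>). The limit of small time steps is \<open>prob_confined_le\<close>.

  The width of the region is an analytic fact about \<open>f\<close> (\<open>width_le\<close>): the third derivative is close
  to \<open>b < 0\<close> near the origin, which bends \<open>f\<close> below \<open>\<kappa> a x\<close> when \<open>\<bar>x\<bar>\<close> exceeds a multiple of \<open>t\<close>. The
  bound \<open>a(t) \<le> C t\<^sup>2\<close> (\<open>a_le_quadratic\<close>) holds because \<open>t \<ge> c\<^sub>1 \<surd>\<sigma>\<close> and \<open>c\<^sub>1\<^sup>2 \<sigma> \<ge> a\<^sub>0\<close> give \<open>a\<^sub>0 \<le> t\<^sup>2\<close>.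
  One can take \<open>c\<^sub>2 = c\<^sub>1\<close>.
\<close>

section \<open>Gaussian densities and independent increments\<close>

text \<open>
  Integrating out a random variable that is independent of a \<open>\<sigma>\<close>-algebra \<open>G\<close>. Taking the identity map
  into \<open>G\<close> as the other variable lets the integrand depend on \<open>\<omega>\<close> through arbitrarily many
  \<open>G\<close>-measurable quantities at once, and independence says exactly that the joint law of
  \<open>(\<omega>, Y \<omega>)\<close> on \<open>G \<Otimes> borel\<close> is a product.
\<close>

lemma (in prob_space) nn_integral_independent:
  assumes G: "subalgebra M G" and Y: "Y \<in> borel_measurable M"
    and indep: "indep_set (sets G) (sets (vimage_algebra (space M) Y borel))"
    and H: "H \<in> borel_measurable (G \<Otimes>\<^sub>M borel)"
  shows "(\<integral>\<^sup>+\<omega>. H (\<omega>, Y \<omega>) \<partial>M) = (\<integral>\<^sup>+\<omega>. (\<integral>\<^sup>+y. H (\<omega>, y) \<partial>distr M borel Y) \<partial>M)"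
proof -
  have id: "(\<lambda>\<omega>. \<omega>) \<in> measurable M G"
    using G by (auto simp: subalgebra_def measurable_def Int_absorb2 sets.sets_into_space)
  have spG: "space G = space M" using G by (simp add: subalgebra_def)
  interpret D: prob_space "distr M borel Y" by (rule prob_space_distr) (rule Y)
  interpret I: prob_space "distr M G (\<lambda>\<omega>. \<omega>)" by (rule prob_space_distr) (rule id)
  have pair: "(\<lambda>\<omega>. (\<omega>, Y \<omega>)) \<in> measurable M (G \<Otimes>\<^sub>M borel)"
    using id Y by (rule measurable_Pair)
  have J: "distr M G (\<lambda>\<omega>. \<omega>) \<Otimes>\<^sub>M distr M borel Y = distr M (G \<Otimes>\<^sub>M borel) (\<lambda>\<omega>. (\<omega>, Y \<omega>))"
  proof (rule pair_measure_eqI)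
    fix A B assume "A \<in> sets (distr M G (\<lambda>\<omega>. \<omega>))" and "B \<in> sets (distr M borel Y)"
    then have A: "A \<in> sets G" and B: "B \<in> sets borel" by simp_all
    have AM: "A \<in> events" "A \<inter> space M = A"
      using A G sets.sets_into_space[OF A] by (auto simp: subalgebra_def)
    have YB: "Y -` B \<inter> space M \<in> events" using Y B by (rule measurable_sets)
    have "prob (A \<inter> (Y -` B \<inter> space M)) = prob A * prob (Y -` B \<inter> space M)"
      using A B by (intro indep_setD[OF indep]) (auto intro: in_vimage_algebra)
    moreover have "(\<lambda>\<omega>. (\<omega>, Y \<omega>)) -` (A \<times> B) \<inter> space M = A \<inter> (Y -` B \<inter> space M)"
      using AM by auto
    ultimately show "emeasure (distr M G (\<lambda>\<omega>. \<omega>)) A * emeasure (distr M borel Y) B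
        = emeasure (distr M (G \<Otimes>\<^sub>M borel) (\<lambda>\<omega>. (\<omega>, Y \<omega>))) (A \<times> B)"
      using A B AM id Y pair
      by (simp add: emeasure_distr emeasure_eq_measure ennreal_mult' measure_nonneg)
  qed (auto intro: D.sigma_finite_measure_axioms I.sigma_finite_measure_axioms cong: sets_pair_measure_cong)
  have H': "H \<in> borel_measurable (distr M G (\<lambda>\<omega>. \<omega>) \<Otimes>\<^sub>M distr M borel Y)"
    using H by (simp cong: measurable_cong_sets)
  have in_meas: "(\<lambda>\<omega>. \<integral>\<^sup>+y. H (\<omega>, y) \<partial>distr M borel Y) \<in> borel_measurable G"
    using D.borel_measurable_nn_integral_fst[OF H'] by (simp cong: measurable_cong_sets)
  have "(\<integral>\<^sup>+\<omega>. H (\<omega>, Y \<omega>) \<partial>M) = (\<integral>\<^sup>+z. H z \<partial>distr M (G \<Otimes>\<^sub>M borel) (\<lambda>\<omega>. (\<omega>, Y \<omega>)))"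
    using pair H by (simp add: nn_integral_distr)
  also have "\<dots> = (\<integral>\<^sup>+\<omega>. (\<integral>\<^sup>+y. H (\<omega>, y) \<partial>distr M borel Y) \<partial>distr M G (\<lambda>\<omega>. \<omega>))"
    unfolding J[symmetric] using D.nn_integral_fst[OF H'] by simp
  also have "\<dots> = (\<integral>\<^sup>+\<omega>. (\<integral>\<^sup>+y. H (\<omega>, y) \<partial>distr M borel Y) \<partial>M)"
    using in_meas by (simp add: nn_integral_distr[OF id])
  finally show ?thesis .
qed

text \<open>
  The derivative of the density is \<open>- z/w\<close> times the density. With \<open>y = \<bar>z\<bar>/\<surd>w\<close> its size is
  \<open>y exp (-y\<^sup>2/2) / (w \<surd>(2\<pi>))\<close>, and \<open>y \<le> 1 + y\<^sup>2/2 \<le> exp (y\<^sup>2/2)\<close>.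
\<close>

lemma normal_density_Lipschitz:
  assumes "0 < w"
  shows "\<bar>normal_density 0 (sqrt w) x - normal_density 0 (sqrt w) y\<bar> \<le> \<bar>x - y\<bar> / w"
proof -
  let ?N = "normal_density 0 (sqrt w)"
  have der: "(?N has_field_derivative (- z / w * ?N z)) (at z within UNIV)" for z
    unfolding normal_density_def using assms
    by (auto intro!: derivative_eq_intros simp: field_simps power2_eq_square)
  have bound: "norm (- z / w * ?N z) \<le> 1 / w" for z
  proof -
    define y where "y = \<bar>z\<bar> / sqrt w"
    have y2: "y\<^sup>2 = z\<^sup>2 / w" using assms by (simp add: y_def power_divide)
    have "y \<le> 1 + y\<^sup>2 / 2" using zero_le_power2[of "y - 1"] by (simp add: power2_eq_square algebra_simps)
    also have "\<dots> \<le> exp (y\<^sup>2 / 2)" by (rule exp_ge_add_one_self)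
    finally have ye: "y * exp (- (y\<^sup>2 / 2)) \<le> 1"
      by (simp add: exp_minus field_simps)
    have "1 \<le> 2 * pi" using pi_gt3 by simp
    then have s: "1 \<le> sqrt (2 * pi)" by (rule real_sqrt_ge_one)
    have "norm (- z / w * ?N z) = (y * exp (- (y\<^sup>2 / 2))) / (sqrt (2 * pi) * w)"
      using assms by (simp add: normal_density_def y2 abs_mult abs_divide real_sqrt_mult)
        (simp add: y_def field_simps)
    also have "\<dots> \<le> 1 / (1 * w)"
      using assms s ye by (intro frac_le mult_mono) (auto simp: y_def)
    finally show ?thesis by simp
  qed
  have "norm (?N x - ?N y) \<le> 1 / w * norm (x - y)"
    by (rule field_differentiable_bound[OF convex_UNIV der bound]) auto
  then show ?thesis by simp
qed

text \<open>
  Averaging a centred Gaussian density over an independent Gaussian increment is a convolution, so it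
  adds the variance \<open>\<nu>\<^sup>2 (s' - s)\<close> of the increment to the variance of the density. The formula is
  exact: the noise causes no discretisation error.
\<close>

lemma expectation_normal_density_increment:
  assumes wp: "wiener_process M F W" and s: "0 \<le> s" "s < s'" and w: "0 < w" and \<nu>: "0 < \<nu>"
    and Y: "Y \<in> borel_measurable (F s)" and C: "C \<in> sets (F s)"
  shows "(\<integral>\<omega>. indicator C \<omega> * normal_density 0 (sqrt w) (Y \<omega> + \<nu> * (W s' \<omega> - W s \<omega>)) \<partial>M)
    = (\<integral>\<omega>. indicator C \<omega> * normal_density 0 (sqrt (w + \<nu>\<^sup>2 * (s' - s))) (Y \<omega>) \<partial>M)"
proof -
  interpret prob_space M using wp by (simp add: wiener_process_def)
  have sub: "subalgebra M (F u)" for u using wp by (simp add: wiener_process_def)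
  let ?D = "\<lambda>\<omega>. W s' \<omega> - W s \<omega>"
  let ?N = "\<lambda>v. normal_density 0 (sqrt v)"
  have dist: "distributed M lborel ?D (normal_density 0 (sqrt (s' - s)))"
    and ind: "indep_set (sets (F s)) (sets (vimage_algebra (space M) ?D borel))"
    using wp s by (auto simp: wiener_process_def)
  have D: "?D \<in> borel_measurable M" using distributed_measurable[OF dist] by simp
  have distD: "distr M borel ?D = density lborel (normal_density 0 (sqrt (s' - s)))"
    using distributed_distr_eq_density[OF dist]
    by (metis (no_types, lifting) distr_cong sets_lborel)
  have meas: "h \<in> borel_measurable (F s) \<Longrightarrow> h \<in> borel_measurable M" for h :: "_ \<Rightarrow> real"
    using measurable_from_subalg[OF sub] by blast
  have YM: "Y \<in> borel_measurable M" by (rule meas[OF Y])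
  have CM: "C \<in> sets M" using C sub by (auto simp: subalgebra_def)
  define H where "H = (\<lambda>(\<omega>, y). ennreal (indicator C \<omega> * ?N w (Y \<omega> + \<nu> * y)))"
  have H: "H \<in> borel_measurable (F s \<Otimes>\<^sub>M borel)"
    unfolding H_def using Y C by measurable
  have conv: "(\<integral>\<^sup>+y. ennreal (?N w (m + \<nu> * y)) \<partial>distr M borel ?D)
      = ennreal (?N (w + \<nu>\<^sup>2 * (s' - s)) m)" for m
  proof -
    let ?v = "\<nu>\<^sup>2 * (s' - s)"
    have v: "0 < ?v" using s \<nu> by simp
    have sqv: "sqrt ?v = \<nu> * sqrt (s' - s)" using \<nu> by (simp add: real_sqrt_mult)
    have scale: "?N (s' - s) y = \<nu> * ?N ?v (\<nu> * y)" for y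
    proof -
      have e: "- (y\<^sup>2 / (2 * (s' - s))) = - ((\<nu> * y)\<^sup>2 / (2 * ?v))"
        using s \<nu> by (simp add: power_mult_distrib field_simps)
      show ?thesis unfolding normal_density_def using s \<nu> e v
        by (simp add: real_sqrt_mult del: sqv) (simp add: power_mult_distrib)
    qed
    have sym: "?N w (m + z) = ?N w (- m - z)" for z
    proof -
      have "(m + z)\<^sup>2 = (- m - z)\<^sup>2" by (simp add: power2_eq_square algebra_simps)
      then show ?thesis by (simp add: normal_density_def)
    qed
    have "(\<integral>\<^sup>+y. ennreal (?N w (m + \<nu> * y)) \<partial>distr M borel ?D)
        = (\<integral>\<^sup>+y. ennreal (?N (s' - s) y) * ennreal (?N w (m + \<nu> * y)) \<partial>lborel)"
      unfolding distD by (subst nn_integral_density) auto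
    also have "\<dots> = (\<integral>\<^sup>+y. ennreal \<bar>\<nu>\<bar> * ennreal (?N w (- m - \<nu> * y) * ?N ?v (\<nu> * y)) \<partial>lborel)"
      using \<nu> by (intro nn_integral_cong)
        (simp add: scale sym ennreal_mult'[symmetric] ennreal_mult[symmetric] mult_ac)
    also have "\<dots> = (\<integral>\<^sup>+y. ennreal (?N w (- m - y) * ?N ?v y) \<partial>lborel)"
      using \<nu> by (subst nn_integral_real_affine[of "\<lambda>y. ennreal (?N w (- m - y) * ?N ?v y)" \<nu> 0])
        (auto simp: nn_integral_cmult)
    also have "\<dots> = ennreal (normal_density 0 (sqrt ((sqrt w)\<^sup>2 + (sqrt ?v)\<^sup>2)) (- m))"
      using conv_normal_density_zero_mean[of "sqrt w" "sqrt ?v"] w v by (simp add: fun_eq_iff)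
    also have "\<dots> = ennreal (?N (w + ?v) m)"
      using w v by (simp add: normal_density_def)
    finally show ?thesis .
  qed
  have "(\<integral>\<^sup>+\<omega>. ennreal (indicator C \<omega> * ?N w (Y \<omega> + \<nu> * ?D \<omega>)) \<partial>M)
      = (\<integral>\<^sup>+\<omega>. (\<integral>\<^sup>+y. H (\<omega>, y) \<partial>distr M borel ?D) \<partial>M)"
    using nn_integral_independent[OF sub D ind H] by (simp add: H_def)
  also have "\<dots> = (\<integral>\<^sup>+\<omega>. ennreal (indicator C \<omega> * ?N (w + \<nu>\<^sup>2 * (s' - s)) (Y \<omega>)) \<partial>M)"
  proof (rule nn_integral_cong)
    fix \<omega>
    show "(\<integral>\<^sup>+y. H (\<omega>, y) \<partial>distr M borel ?D)
        = ennreal (indicator C \<omega> * ?N (w + \<nu>\<^sup>2 * (s' - s)) (Y \<omega>))"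
      by (cases "\<omega> \<in> C") (simp_all add: H_def conv)
  qed
  finally have eq: "(\<integral>\<^sup>+\<omega>. ennreal (indicator C \<omega> * ?N w (Y \<omega> + \<nu> * ?D \<omega>)) \<partial>M)
      = (\<integral>\<^sup>+\<omega>. ennreal (indicator C \<omega> * ?N (w + \<nu>\<^sup>2 * (s' - s)) (Y \<omega>)) \<partial>M)" .
  have m1: "(\<lambda>\<omega>. indicator C \<omega> * ?N w (Y \<omega> + \<nu> * ?D \<omega>)) \<in> borel_measurable M"
    and m2: "(\<lambda>\<omega>. indicator C \<omega> * ?N (w + \<nu>\<^sup>2 * (s' - s)) (Y \<omega>)) \<in> borel_measurable M"
    using YM CM D by measurable
  show ?thesis
    using eq by (subst (1 2) integral_eq_nn_integral) (auto intro: m1 m2)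
qed

text \<open>
  Stated for intervals inside a compact set \<open>K\<close>, because it is applied with \<open>K\<close> the set of times at which a
  path is inside a region; that set need not be an interval.
\<close>

lemma integral_near_left_endpoint_product:
  fixes \<phi> :: "real \<Rightarrow> real"
  assumes "compact K" "continuous_on K \<phi>" "0 < e"
  obtains \<rho> where "0 < \<rho>"
    "\<And>u v. u \<le> v \<Longrightarrow> v - u < \<rho> \<Longrightarrow> {u..v} \<subseteq> K \<Longrightarrow> \<bar>integral {u..v} \<phi> - (v - u) * \<phi> u\<bar> \<le> e * (v - u)"
proof -
  have "uniformly_continuous_on K \<phi>" using assms(1,2) by (rule compact_uniformly_continuous[rotated])
  then obtain \<rho> where \<rho>: "0 < \<rho>"
    and close: "\<And>x y. x \<in> K \<Longrightarrow> y \<in> K \<Longrightarrow> dist y x < \<rho> \<Longrightarrow> dist (\<phi> y) (\<phi> x) < e"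
    using assms(3) unfolding uniformly_continuous_on_def by metis
  show ?thesis
  proof (rule that[OF \<rho>])
    fix u v :: real assume uv: "u \<le> v" "v - u < \<rho>" "{u..v} \<subseteq> K"
    have c: "continuous_on {u..v} \<phi>" using assms(2) uv(3) by (rule continuous_on_subset)
    have int: "(\<lambda>z. \<phi> z - \<phi> u) integrable_on {u..v}"
      by (intro integrable_continuous_interval continuous_intros c)
    have "integral {u..v} \<phi> - (v - u) * \<phi> u = integral {u..v} (\<lambda>z. \<phi> z - \<phi> u)"
      using uv(1) by (subst integral_diff) (auto intro: integrable_continuous_interval c)
    also have "norm \<dots> \<le> integral {u..v} (\<lambda>z. e)"
    proof (rule integral_norm_bound_integral[OF int])
      fix z assume z: "z \<in> {u..v}"
      have "dist (\<phi> z) (\<phi> u) < e" using z uv by (intro close) (auto simp: dist_real_def)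
      then show "norm (\<phi> z - \<phi> u) \<le> e" by (simp add: dist_real_def)
    qed (rule integrable_const_ivl)
    finally show "\<bar>integral {u..v} \<phi> - (v - u) * \<phi> u\<bar> \<le> e * (v - u)" using uv(1) by (simp add: mult.commute)
  qed
qed

section \<open>Confinement of a repelled diffusion to a compact region\<close>

lemma exp_minus_square_le:
  assumes "0 \<le> (p::real)"
  shows "exp (p - p\<^sup>2) \<le> 1 + p"
proof (cases "p \<le> 1")
  case True
  have "p - p\<^sup>2 \<le> ln (1 + p)" using assms True by (rule ln_one_plus_pos_lower_bound)
  moreover have "0 < 1 + p" using assms by simp
  ultimately show ?thesis by (rule iffD1[OF ln_ge_iff, rotated])
next
  case False
  then have "p - p\<^sup>2 \<le> 0" by (simp add: power2_eq_square)
  then have "exp (p - p\<^sup>2) \<le> 1" by simp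
  also have "1 \<le> 1 + p" using assms by simp
  finally show ?thesis .
qed

text \<open>
  A solution of \<open>dX = g(X,s) ds + \<nu> dW\<close> on \<open>[t0, t]\<close>, together with a compact space-time region \<open>R\<close> in
  which the drift repels from the origin at least as strongly as the linear drift \<open>lam(s) x\<close>. At the final time
  the region has half-width at most \<open>h\<close>.
\<close>

locale confined_solution =
  fixes M :: "'w measure" and F :: "real \<Rightarrow> 'w measure" and W X :: "real \<Rightarrow> 'w \<Rightarrow> real"
    and g :: "real \<Rightarrow> real \<Rightarrow> real" and lam :: "real \<Rightarrow> real" and R :: "(real \<times> real) set"
    and t0 t \<nu> L h :: real
  assumes wiener: "wiener_process M F W"
    and t0_nonneg: "0 \<le> t0" and t0_less: "t0 < t" and \<nu>_pos: "0 < \<nu>"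
    and adapted: "\<And>s. t0 \<le> s \<Longrightarrow> X s \<in> borel_measurable (F s)"
    and paths: "\<And>\<omega>. \<omega> \<in> space M \<Longrightarrow> continuous_on {t0..} (\<lambda>s. X s \<omega>)"
    and equation: "AE \<omega> in M. \<forall>s\<ge>t0.
      X s \<omega> = X t0 \<omega> + (LBINT u:{t0..s}. g (X u \<omega>) u) + \<nu> * (W s \<omega> - W t0 \<omega>)"
    and R_compact: "compact R" and g_cont: "continuous_on R (\<lambda>(x, s). g x s)"
    and lam_cont: "continuous_on {t0..t} lam"
    and lam_pos: "\<And>s. s \<in> {t0..t} \<Longrightarrow> 0 < lam s"
    and lam_le: "\<And>s. s \<in> {t0..t} \<Longrightarrow> lam s \<le> L"
    and outward: "\<And>x s. (x, s) \<in> R \<Longrightarrow> s \<in> {t0..t} \<Longrightarrow> lam s * x\<^sup>2 \<le> x * g x s"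
    and final_width: "\<And>x. (x, t) \<in> R \<Longrightarrow> \<bar>x\<bar> \<le> h"
    and h_pos: "0 < h"
begin

sublocale prob_space M using wiener by (simp add: wiener_process_def)

lemma subalgebra_F: "subalgebra M (F s)"
  using wiener by (simp add: wiener_process_def)

lemma filtration_F: "filtration (space M) F"
  using wiener by (simp add: wiener_process_def)

lemma space_F [simp]: "space (F s) = space M"
  using subalgebra_F by (simp add: subalgebra_def)

lemma measurable_F: "Y \<in> borel_measurable (F s) \<Longrightarrow> Y \<in> borel_measurable M"
  using measurable_from_subalg[OF subalgebra_F] by blast

lemma adapted_later: "t0 \<le> s \<Longrightarrow> s \<le> u \<Longrightarrow> X s \<in> borel_measurable (F u)"
  using adapted[of s] filtration.sets_F_mono[OF filtration_F, of s u]
  by (auto simp: measurable_def)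

lemma L_pos: "0 < L"
  using lam_pos[of t] lam_le[of t] t0_less by simp

lemma closed_R: "closed R" using R_compact by (rule compact_imp_closed)

subsection \<open>The event of confinement\<close>

definition confined :: "real \<Rightarrow> 'w set" where
  "confined s = {\<omega> \<in> space M. \<forall>u\<in>{t0..s}. (X u \<omega>, u) \<in> R}"

lemma closed_section: "closed {x. (x, s) \<in> R}"
proof -
  have "closed ((\<lambda>x. (x, s)) -` R)"
    by (intro closed_vimage closed_R continuous_intros)
  then show ?thesis by (simp add: vimage_def)
qed

definition sojourn :: "'w \<Rightarrow> real set" where
  "sojourn \<omega> = {s \<in> {t0..t}. (X s \<omega>, s) \<in> R}"

lemma compact_sojourn:
  assumes "\<omega> \<in> space M"
  shows "compact (sojourn \<omega>)"
proof -
  have "continuous_on {t0..t} (\<lambda>s. (X s \<omega>, s))"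
    by (intro continuous_intros continuous_on_subset[OF paths[OF assms]]) auto
  then have "closed ({t0..t} \<inter> (\<lambda>s. (X s \<omega>, s)) -` R)"
    by (rule continuous_closed_preimage) (auto intro: closed_R)
  moreover have "{t0..t} \<inter> (\<lambda>s. (X s \<omega>, s)) -` R = sojourn \<omega>"
    by (auto simp: sojourn_def)
  ultimately have "closed (sojourn \<omega>)" by simp
  moreover have "bounded (sojourn \<omega>)"
    by (rule bounded_subset[of "{t0..t}"]) (auto simp: sojourn_def)
  ultimately show ?thesis by (simp add: compact_eq_bounded_closed)
qed

lemma continuous_on_sojourn:
  assumes "\<omega> \<in> space M"
  shows "continuous_on (sojourn \<omega>) (\<lambda>s. g (X s \<omega>) s)"
proof -
  have c: "continuous_on (sojourn \<omega>) (\<lambda>s. (X s \<omega>, s))"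
    by (intro continuous_intros continuous_on_subset[OF paths[OF assms]]) (auto simp: sojourn_def)
  have "continuous_on (sojourn \<omega>) (\<lambda>s. (\<lambda>(x, s). g x s) (X s \<omega>, s))"
    by (rule continuous_on_compose2[OF g_cont c]) (auto simp: sojourn_def)
  then show ?thesis by simp
qed

lemma confined_subset_sojourn:
  "\<omega> \<in> confined s \<Longrightarrow> s \<le> t \<Longrightarrow> {t0..s} \<subseteq> sojourn \<omega>"
  by (auto simp: confined_def sojourn_def)

lemma confined_mono: "s \<le> s' \<Longrightarrow> confined s' \<subseteq> confined s"
  by (auto simp: confined_def)

text \<open>
  The times at which a path is inside \<open>R\<close> form a closed set, so the uncountably many conditions reduce
  to those at a countable dense set of times.
\<close>

lemma confined_measurable:
  assumes s: "t0 \<le> s" "s \<le> t"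
  shows "confined s \<in> sets (F s)"
proof -
  obtain S where S: "countable S" "S \<subseteq> {t0..s}" "{t0..s} \<subseteq> closure S"
    by (rule separable)
  have ne: "S \<noteq> {}" using S s by auto
  have "confined s = (\<Inter>u\<in>S. {\<omega> \<in> space (F s). (X u \<omega>, u) \<in> R})"
  proof (intro equalityI subsetI)
    fix \<omega> assume "\<omega> \<in> confined s"
    then show "\<omega> \<in> (\<Inter>u\<in>S. {\<omega> \<in> space (F s). (X u \<omega>, u) \<in> R})"
      using S by (auto simp: confined_def)
  next
    fix \<omega> assume \<omega>: "\<omega> \<in> (\<Inter>u\<in>S. {\<omega> \<in> space (F s). (X u \<omega>, u) \<in> R})"
    then have sp: "\<omega> \<in> space M" using ne by auto
    have "S \<subseteq> sojourn \<omega>" using \<omega> S s by (auto simp: sojourn_def)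
    then have "closure S \<subseteq> sojourn \<omega>"
      using compact_imp_closed[OF compact_sojourn[OF sp]] by (rule closure_minimal)
    then show "\<omega> \<in> confined s" using S sp by (auto simp: confined_def sojourn_def)
  qed
  moreover have "{\<omega> \<in> space (F s). (X u \<omega>, u) \<in> R} \<in> sets (F s)" if "u \<in> S" for u
  proof -
    have "X u -` {x. (x, u) \<in> R} \<inter> space (F s) \<in> sets (F s)"
      using that S by (intro measurable_sets[OF adapted_later] borel_closed closed_section) auto
    moreover have "X u -` {x. (x, u) \<in> R} \<inter> space (F s) = {\<omega> \<in> space (F s). (X u \<omega>, u) \<in> R}"
      by auto
    ultimately show ?thesis by simp
  qed
  ultimately show ?thesis using S(1) ne by (auto intro!: sets.countable_INT')
qed

lemma confined_event: "t0 \<le> s \<Longrightarrow> s \<le> t \<Longrightarrow> confined s \<in> events"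
  using confined_measurable[of s] subalgebra_F[of s] by (auto simp: subalgebra_def)

text \<open>
  The closed region absorbs the endpoint: confinement up to but excluding \<open>t\<close> extends to \<open>t\<close> by
  continuity of the path.
\<close>

lemma confined_if_before:
  assumes "\<omega> \<in> space M" "\<And>s. t0 \<le> s \<Longrightarrow> s < t \<Longrightarrow> (X s \<omega>, s) \<in> R"
  shows "\<omega> \<in> confined t"
proof -
  have "{t0..<t} \<subseteq> sojourn \<omega>" using assms(2) by (auto simp: sojourn_def)
  then have "closure {t0..<t} \<subseteq> sojourn \<omega>"
    using compact_imp_closed[OF compact_sojourn[OF assms(1)]] by (rule closure_minimal)
  then have "{t0..t} \<subseteq> sojourn \<omega>" using t0_less by simp
  then show ?thesis using assms(1) by (auto simp: confined_def sojourn_def)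
qed

subsection \<open>The error of the Euler scheme on the confined paths\<close>

definition step :: "nat \<Rightarrow> real" where "step n = (t - t0) / real n"

definition grid :: "nat \<Rightarrow> nat \<Rightarrow> real" where "grid n k = t0 + real k * step n"

lemma step_pos: "0 < n \<Longrightarrow> 0 < step n"
  using t0_less by (simp add: step_def)

lemma step_nonneg: "0 \<le> step n"
  using t0_less by (simp add: step_def)

lemma step_total: "0 < n \<Longrightarrow> real n * step n = t - t0"
  by (simp add: step_def)

lemma step_tendsto: "step \<longlonglongrightarrow> 0"
  unfolding step_def by (rule lim_const_over_n)

lemma grid_0 [simp]: "grid n 0 = t0" by (simp add: grid_def)

lemma grid_n: "0 < n \<Longrightarrow> grid n n = t" by (simp add: grid_def step_total)

lemma grid_Suc: "grid n (Suc k) = grid n k + step n"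
  by (simp add: grid_def algebra_simps)

lemma grid_ge: "t0 \<le> grid n k" by (simp add: grid_def step_nonneg)

lemma grid_le: "k \<le> n \<Longrightarrow> 0 < n \<Longrightarrow> grid n k \<le> t"
  using mult_right_mono[of "real k" "real n" "step n"] step_nonneg[of n] step_total[of n]
  by (simp add: grid_def)

text \<open>
  Setting the drift to zero outside \<open>R\<close> makes it Borel measurable in \<open>x\<close> while changing nothing on the
  confined paths.
\<close>

definition drift :: "real \<Rightarrow> real \<Rightarrow> real" where
  "drift x s = (if (x, s) \<in> R then g x s else 0)"

lemma drift_measurable: "(\<lambda>x. drift x s) \<in> borel_measurable borel"
proof -
  have c: "continuous_on {x. (x, s) \<in> R} (\<lambda>x. g x s)"
  proof -
    have "continuous_on {x. (x, s) \<in> R} (\<lambda>x. (\<lambda>(x, s). g x s) (x, s))"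
      by (rule continuous_on_compose2[OF g_cont]) (auto intro!: continuous_intros)
    then show ?thesis by simp
  qed
  have "(\<lambda>x. indicator {x. (x, s) \<in> R} x *\<^sub>R g x s) \<in> borel_measurable borel"
    by (rule borel_measurable_continuous_on_indicator[OF _ c]) (intro borel_closed closed_section)
  moreover have "(\<lambda>x. indicator {x. (x, s) \<in> R} x *\<^sub>R g x s) = (\<lambda>x. drift x s)"
    by (auto simp: drift_def)
  ultimately show ?thesis by simp
qed

definition euler :: "nat \<Rightarrow> nat \<Rightarrow> 'w \<Rightarrow> real" where
  "euler n k \<omega> = X (grid n k) \<omega> + step n * drift (X (grid n k) \<omega>) (grid n k)"

definition noise :: "nat \<Rightarrow> nat \<Rightarrow> 'w \<Rightarrow> real" where
  "noise n k \<omega> = \<nu> * (W (grid n (Suc k)) \<omega> - W (grid n k) \<omega>)"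

text \<open>
  The indicator concerns the end of the time step: only then is the path known to be inside \<open>R\<close> during
  the whole step, where the drift is bounded and continuous.
\<close>

definition euler_error :: "nat \<Rightarrow> nat \<Rightarrow> 'w \<Rightarrow> real" where
  "euler_error n k \<omega> = indicator (confined (grid n (Suc k))) \<omega> *
     \<bar>X (grid n (Suc k)) \<omega> - (euler n k \<omega> + noise n k \<omega>)\<bar>"

lemma euler_adapted: "euler n k \<in> borel_measurable (F (grid n k))"
proof -
  have X: "X (grid n k) \<in> borel_measurable (F (grid n k))" by (rule adapted[OF grid_ge])
  have "(\<lambda>\<omega>. drift (X (grid n k) \<omega>) (grid n k)) \<in> borel_measurable (F (grid n k))"
    by (rule measurable_compose[OF X drift_measurable])
  with X show ?thesis unfolding euler_def by measurable
qed

lemma noise_measurable: "noise n k \<in> borel_measurable M"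
proof -
  have "W s \<in> borel_measurable M" if "0 \<le> s" for s
    using wiener that measurable_F by (auto simp: wiener_process_def)
  moreover have "0 \<le> grid n j" for j using grid_ge[of n j] t0_nonneg by simp
  ultimately show ?thesis unfolding noise_def by measurable
qed

lemma X_measurable: "X (grid n k) \<in> borel_measurable M"
  by (rule measurable_F[OF adapted[OF grid_ge]])

lemma euler_error_measurable:
  assumes "k < n"
  shows "euler_error n k \<in> borel_measurable M"
proof -
  have "confined (grid n (Suc k)) \<in> events"
    using assms by (intro confined_event grid_ge grid_le) auto
  moreover note X_measurable[of n "Suc k"] measurable_F[OF euler_adapted[of n k]] noise_measurable[of n k]
  ultimately show ?thesis unfolding euler_error_def by measurable
qed

text \<open>
  On the confined paths the error of one Euler step is that of the left endpoint rule for the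
  integral of the drift along the path.
\<close>

lemma AE_euler_error:
  "AE \<omega> in M. \<forall>n k. k < n \<longrightarrow> euler_error n k \<omega> = indicator (confined (grid n (Suc k))) \<omega> *
     \<bar>integral {grid n k..grid n (Suc k)} (\<lambda>s. g (X s \<omega>) s) - step n * g (X (grid n k) \<omega>) (grid n k)\<bar>"
  using equation
proof (eventually_elim, intro allI impI)
  fix \<omega> and n k :: nat
  assume eq: "\<forall>s\<ge>t0. X s \<omega> = X t0 \<omega> + (LBINT u:{t0..s}. g (X u \<omega>) u) + \<nu> * (W s \<omega> - W t0 \<omega>)"
    and kn: "k < n"
  let ?s = "grid n k" and ?s' = "grid n (Suc k)" and ?\<phi> = "\<lambda>s. g (X s \<omega>) s"
  show "euler_error n k \<omega> = indicator (confined ?s') \<omega> * \<bar>integral {?s..?s'} ?\<phi> - step n * ?\<phi> ?s\<bar>"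
  proof (cases "\<omega> \<in> confined ?s'")
    case True
    have s't: "?s' \<le> t" using kn by (intro grid_le) auto
    have ss': "?s \<le> ?s'" by (simp add: grid_Suc step_nonneg)
    have sub: "{t0..?s'} \<subseteq> sojourn \<omega>" by (rule confined_subset_sojourn[OF True s't])
    have sp: "\<omega> \<in> space M" using True by (simp add: confined_def)
    have c: "continuous_on {t0..?s'} ?\<phi>"
      using continuous_on_sojourn[OF sp] sub by (rule continuous_on_subset)
    have leb: "(LBINT u:{t0..v}. ?\<phi> u) = integral {t0..v} ?\<phi>" if "v \<le> ?s'" for v
      using that by (intro set_borel_integral_eq_integral(2) borel_integrable_atLeastAtMost'
          continuous_on_subset[OF c]) auto
    have comb: "integral {t0..?s} ?\<phi> + integral {?s..?s'} ?\<phi> = integral {t0..?s'} ?\<phi>"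
      using grid_ge ss' by (intro Henstock_Kurzweil_Integration.integral_combine integrable_continuous_interval c)
    have R: "(X ?s \<omega>, ?s) \<in> R" using True ss' grid_ge[of n k] by (auto simp: confined_def)
    have e: "X ?s' \<omega> - X ?s \<omega> = integral {?s..?s'} ?\<phi> + \<nu> * (W ?s' \<omega> - W ?s \<omega>)"
      using eq[rule_format, of ?s] eq[rule_format, of ?s'] leb[of ?s] leb[of ?s'] comb ss'
        grid_ge[of n k] grid_ge[of n "Suc k"] by (simp add: algebra_simps)
    have "X ?s' \<omega> - (euler n k \<omega> + noise n k \<omega>) = integral {?s..?s'} ?\<phi> - step n * ?\<phi> ?s"
      using e R by (simp add: euler_def noise_def drift_def)
    then show ?thesis by (simp add: euler_error_def)
  qed (simp add: euler_error_def)
qed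

text \<open>
  A bound uniform in \<open>n\<close>, which serves as dominating constant: each of the \<open>n\<close> steps contributes
  at most twice its length times the maximum of \<open>\<bar>g\<bar>\<close> on \<open>R\<close>.
\<close>

lemma total_euler_error_bounded:
  "\<exists>B. AE \<omega> in M. \<forall>n. \<bar>\<Sum>k<n. euler_error n k \<omega>\<bar> \<le> B"
proof -
  have "compact ((\<lambda>(x, s). g x s) ` R)" by (rule compact_continuous_image[OF g_cont R_compact])
  then have "bounded ((\<lambda>(x, s). g x s) ` R)" by (rule compact_imp_bounded)
  then obtain G where G0: "0 < G" and "\<forall>y\<in>(\<lambda>(x, s). g x s) ` R. norm y \<le> G"
    unfolding bounded_pos by blast
  then have G: "0 < G" "\<And>x s. (x, s) \<in> R \<Longrightarrow> \<bar>g x s\<bar> \<le> G" by force+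
  have "AE \<omega> in M. \<forall>n. \<bar>\<Sum>k<n. euler_error n k \<omega>\<bar> \<le> 2 * G * (t - t0)"
    using AE_euler_error AE_space
  proof (eventually_elim, intro allI)
    fix \<omega> n
    assume E: "\<forall>n k. k < n \<longrightarrow> euler_error n k \<omega> = indicator (confined (grid n (Suc k))) \<omega> *
     \<bar>integral {grid n k..grid n (Suc k)} (\<lambda>s. g (X s \<omega>) s) - step n * g (X (grid n k) \<omega>) (grid n k)\<bar>"
      and sp: "\<omega> \<in> space M"
    let ?\<phi> = "\<lambda>s. g (X s \<omega>) s"
    have one: "\<bar>euler_error n k \<omega>\<bar> \<le> 2 * G * step n" if kn: "k < n" for k
    proof (cases "\<omega> \<in> confined (grid n (Suc k))")
      case True
      let ?s = "grid n k" and ?s' = "grid n (Suc k)"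
      have s't: "?s' \<le> t" using kn by (intro grid_le) auto
      have ss': "?s \<le> ?s'" by (simp add: grid_Suc step_nonneg)
      have sub: "{?s..?s'} \<subseteq> sojourn \<omega>"
        using confined_subset_sojourn[OF True s't] grid_ge[of n k] by auto
      have b: "\<bar>?\<phi> u\<bar> \<le> G" if "u \<in> {?s..?s'}" for u
        using sub that G(2) by (auto simp: sojourn_def)
      have c: "continuous_on {?s..?s'} ?\<phi>"
        using continuous_on_sojourn[OF sp] sub by (rule continuous_on_subset)
      have "norm (integral {?s..?s'} ?\<phi>) \<le> integral {?s..?s'} (\<lambda>_. G)"
        by (intro integral_norm_bound_integral integrable_continuous_interval c) (auto simp: b)
      then have 1: "\<bar>integral {?s..?s'} ?\<phi>\<bar> \<le> G * step n"
        using ss' by (simp add: grid_Suc step_nonneg mult.commute)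
      have 2: "\<bar>step n * ?\<phi> ?s\<bar> \<le> G * step n"
        using mult_left_mono[OF b[of ?s] step_nonneg[of n]] ss' step_nonneg[of n]
      by (simp add: abs_mult mult.commute)
      have "\<bar>integral {?s..?s'} ?\<phi> - step n * ?\<phi> ?s\<bar> \<le> 2 * G * step n"
        using 1 2 by linarith
      then show ?thesis using E kn True by simp
    next
      case False
      then show ?thesis using G(1) step_nonneg[of n] by (simp add: euler_error_def)
    qed
    have "\<bar>\<Sum>k<n. euler_error n k \<omega>\<bar> \<le> (\<Sum>k<n. 2 * G * step n)"
      using one by (intro order_trans[OF sum_abs sum_mono]) auto
    also have "\<dots> \<le> 2 * G * (t - t0)"
      using step_total[of n] G(1) t0_less by (cases "n = 0") (simp_all add: mult_ac)
    finally show "\<bar>\<Sum>k<n. euler_error n k \<omega>\<bar> \<le> 2 * G * (t - t0)" .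
  qed
  then show ?thesis by blast
qed

text \<open>
  Along one path, the drift is uniformly continuous on the compact set of times spent in \<open>R\<close>, so
  each step contributes at most its length times a modulus of continuity. The modulus
  depends on the path; uniformity in the path is supplied by the preceding bound.
\<close>

lemma total_euler_error_tendsto:
  "AE \<omega> in M. (\<lambda>n. \<Sum>k<n. euler_error n k \<omega>) \<longlonglongrightarrow> 0"
  using AE_euler_error AE_space
proof (eventually_elim, intro LIMSEQ_I)
  fix \<omega> and e :: real
  assume E: "\<forall>n k. k < n \<longrightarrow> euler_error n k \<omega> = indicator (confined (grid n (Suc k))) \<omega> *
     \<bar>integral {grid n k..grid n (Suc k)} (\<lambda>s. g (X s \<omega>) s) - step n * g (X (grid n k) \<omega>) (grid n k)\<bar>"
    and sp: "\<omega> \<in> space M" and e: "0 < e"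
  let ?\<phi> = "\<lambda>s. g (X s \<omega>) s"
  define e' where "e' = e / (2 * (t - t0))"
  have e': "0 < e'" using e t0_less by (simp add: e'_def)
  obtain \<rho> where \<rho>: "0 < \<rho>" and cell: "\<And>u v. u \<le> v \<Longrightarrow> v - u < \<rho> \<Longrightarrow> {u..v} \<subseteq> sojourn \<omega> \<Longrightarrow>
      \<bar>integral {u..v} ?\<phi> - (v - u) * ?\<phi> u\<bar> \<le> e' * (v - u)"
    by (rule integral_near_left_endpoint_product[OF compact_sojourn[OF sp] continuous_on_sojourn[OF sp] e']) blast
  have "eventually (\<lambda>n. step n < \<rho>) sequentially"
    using step_tendsto \<rho> by (rule order_tendstoD)
  then obtain N where N: "\<And>n. n \<ge> N \<Longrightarrow> step n < \<rho>" by (auto simp: eventually_sequentially)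
  show "\<exists>no. \<forall>n\<ge>no. norm ((\<Sum>k<n. euler_error n k \<omega>) - 0) < e"
  proof (intro exI allI impI)
    fix n assume n: "N \<le> n"
    have one: "\<bar>euler_error n k \<omega>\<bar> \<le> e' * step n" if kn: "k < n" for k
    proof (cases "\<omega> \<in> confined (grid n (Suc k))")
      case True
      let ?s = "grid n k" and ?s' = "grid n (Suc k)"
      have s't: "?s' \<le> t" using kn by (intro grid_le) auto
      have sub: "{?s..?s'} \<subseteq> sojourn \<omega>"
        using confined_subset_sojourn[OF True s't] grid_ge[of n k] by auto
      have "\<bar>integral {?s..?s'} ?\<phi> - step n * ?\<phi> ?s\<bar> \<le> e' * step n"
        using cell[OF _ _ sub] N[OF n] step_nonneg[of n] by (simp add: grid_Suc)
      then show ?thesis using E kn True by simp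
    next
      case False
      then show ?thesis using e' step_nonneg[of n] by (simp add: euler_error_def)
    qed
    have "\<bar>\<Sum>k<n. euler_error n k \<omega>\<bar> \<le> (\<Sum>k<n. e' * step n)"
      using one by (intro order_trans[OF sum_abs sum_mono]) auto
    also have "\<dots> \<le> e' * (t - t0)"
      using step_total[of n] e' t0_less by (cases "n = 0") (simp_all add: mult_ac)
    also have "\<dots> < e" using e t0_less unfolding e'_def by (simp add: field_simps)
    finally show "norm ((\<Sum>k<n. euler_error n k \<omega>) - 0) < e" by simp
  qed
qed

lemma integrable_euler_error:
  assumes "k < n"
  shows "integrable M (euler_error n k)"
proof -
  obtain B where B: "AE \<omega> in M. \<forall>n. \<bar>\<Sum>k<n. euler_error n k \<omega>\<bar> \<le> B"
    using total_euler_error_bounded by blast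
  have "AE \<omega> in M. norm (euler_error n k \<omega>) \<le> B"
    using B
  proof eventually_elim
    fix \<omega> assume *: "\<forall>n. \<bar>\<Sum>k<n. euler_error n k \<omega>\<bar> \<le> B"
    have "euler_error n k \<omega> \<le> (\<Sum>k<n. euler_error n k \<omega>)"
      using assms by (intro member_le_sum) (auto simp: euler_error_def)
    moreover have "0 \<le> euler_error n k \<omega>" by (simp add: euler_error_def)
    ultimately show "norm (euler_error n k \<omega>) \<le> B" using *[rule_format, of n] by simp
  qed
  then show ?thesis by (rule integrable_const_bound) (rule euler_error_measurable[OF assms])
qed

lemma expected_euler_error_tendsto:
  "(\<lambda>n. \<Sum>k<n. expectation (euler_error n k)) \<longlonglongrightarrow> 0"
proof -
  obtain B where B: "AE \<omega> in M. \<forall>n. \<bar>\<Sum>k<n. euler_error n k \<omega>\<bar> \<le> B"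
    using total_euler_error_bounded by blast
  have "(\<lambda>n. expectation (\<lambda>\<omega>. \<Sum>k<n. euler_error n k \<omega>)) \<longlonglongrightarrow> expectation (\<lambda>\<omega>. 0)"
  proof (rule integral_dominated_convergence[where w = "\<lambda>_. B"])
    show "AE \<omega> in M. (\<lambda>n. \<Sum>k<n. euler_error n k \<omega>) \<longlonglongrightarrow> 0"
      by (rule total_euler_error_tendsto)
    show "AE \<omega> in M. norm (\<Sum>k<n. euler_error n k \<omega>) \<le> B" for n
      using B by eventually_elim simp
  qed (auto intro!: borel_measurable_sum euler_error_measurable)
  moreover have "expectation (\<lambda>\<omega>. \<Sum>k<n. euler_error n k \<omega>) = (\<Sum>k<n. expectation (euler_error n k))" for n
    by (rule Bochner_Integration.integral_sum) (auto intro: integrable_euler_error)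
  ultimately show ?thesis by simp
qed

subsection \<open>A discrete supermartingale of Gaussian densities\<close>

text \<open>
  A Gaussian density of variance \<open>w\<close> at time \<open>s + \<eta>\<close> becomes one of variance \<open>w + \<nu>\<^sup>2 \<eta>\<close> after averaging over
  the noise of the step, and the drift then rescales it by \<open>x\<^sup>2 \<mapsto> (1 + p) x\<^sup>2\<close> with \<open>p = 2 \<eta> lam(s)\<close>. The
  variances of the test functions are therefore chosen to satisfy
  \<open>(1 + p\<^sub>k) w\<^sub>k = w\<^sub>k\<^sub>+\<^sub>1 + \<nu>\<^sup>2 \<eta>\<close>, ending at \<open>w\<^sub>n = h\<^sup>2\<close>; \<open>test_var\<close> is the solution of this backward recursion
  and \<open>growth\<close> the product of the factors \<open>1 + p\<^sub>i\<close>. The normalisation of the density loses a factor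
  \<open>1 / \<surd>(1 + p)\<close> in each step, and the product of these factors is the source of the exponential decay.
\<close>

definition rate :: "nat \<Rightarrow> nat \<Rightarrow> real" where
  "rate n k = 2 * step n * lam (grid n k)"

definition growth :: "nat \<Rightarrow> nat \<Rightarrow> real" where
  "growth n k = (\<Prod>i<k. 1 + rate n i)"

definition test_var :: "nat \<Rightarrow> nat \<Rightarrow> real" where
  "test_var n k = growth n k * (h\<^sup>2 / growth n n + \<nu>\<^sup>2 * step n * (\<Sum>j=k..<n. 1 / growth n (Suc j)))"

lemma rate_bounds:
  assumes "k < n"
  shows "0 \<le> rate n k" "rate n k \<le> 2 * L * step n"
proof -
  have g: "grid n k \<in> {t0..t}" using assms grid_ge grid_le[of k n] by auto
  show "0 \<le> rate n k" using lam_pos[OF g] step_nonneg[of n] by (simp add: rate_def)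
  show "rate n k \<le> 2 * L * step n"
    using mult_right_mono[OF lam_le[OF g] step_nonneg[of n]] by (simp add: rate_def mult_ac)
qed

lemma growth_0 [simp]: "growth n 0 = 1" by (simp add: growth_def)

lemma growth_Suc: "growth n (Suc k) = growth n k * (1 + rate n k)"
  by (simp add: growth_def)

lemma growth_ge_1: "k \<le> n \<Longrightarrow> 1 \<le> growth n k"
  unfolding growth_def using rate_bounds by (intro prod_ge_1) force

lemma growth_le:
  assumes "0 < n"
  shows "growth n n \<le> exp (2 * L * (t - t0))"
proof -
  have "growth n n \<le> (\<Prod>i<n. exp (rate n i))"
    unfolding growth_def using rate_bounds(1) by (intro prod_mono) (auto simp: exp_ge_add_one_self)
  also have "\<dots> = exp (\<Sum>i<n. rate n i)" by (simp add: exp_sum)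
  also have "(\<Sum>i<n. rate n i) \<le> (\<Sum>i<n. 2 * L * step n)"
    by (intro sum_mono rate_bounds) auto
  also have "\<dots> = 2 * L * (t - t0)" using step_total[OF assms] by (simp add: mult_ac)
  finally show ?thesis by simp
qed

lemma test_var_final: "0 < n \<Longrightarrow> test_var n n = h\<^sup>2"
  using growth_ge_1[of n n] by (simp add: test_var_def)

lemma test_var_step:
  assumes "k < n"
  shows "(1 + rate n k) * test_var n k = test_var n (Suc k) + \<nu>\<^sup>2 * step n"
proof -
  have pos: "growth n (Suc k) > 0" using growth_ge_1[of "Suc k" n] assms by simp
  have sum: "(\<Sum>j=k..<n. 1 / growth n (Suc j)) = 1 / growth n (Suc k) + (\<Sum>j=Suc k..<n. 1 / growth n (Suc j))"
    using assms by (rule sum.atLeast_Suc_lessThan)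
  have "(1 + rate n k) * test_var n k
      = growth n (Suc k) * (h\<^sup>2 / growth n n + \<nu>\<^sup>2 * step n * (\<Sum>j=k..<n. 1 / growth n (Suc j)))"
    by (simp add: test_var_def growth_Suc)
  also have "\<dots> = test_var n (Suc k) + \<nu>\<^sup>2 * step n"
    unfolding sum test_var_def using pos by (simp add: field_simps)
  finally show ?thesis .
qed

text \<open>This keeps the Lipschitz constants of the test functions bounded uniformly in \<open>k\<close> and \<open>n\<close>.\<close>

lemma test_var_lower:
  assumes "k \<le> n" "0 < n"
  shows "h\<^sup>2 * exp (- (2 * L * (t - t0))) \<le> test_var n k"
proof -
  have g: "1 \<le> growth n k" using growth_ge_1[of k n] assms by simp
  have gn: "1 \<le> growth n n" by (rule growth_ge_1) simp
  let ?S = "\<Sum>j=k..<n. 1 / growth n (Suc j)"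
  have S: "0 \<le> ?S"
  proof (rule sum_nonneg)
    fix j assume "j \<in> {k..<n}"
    then show "0 \<le> 1 / growth n (Suc j)" using growth_ge_1[of "Suc j" n] by simp
  qed
  have "h\<^sup>2 * exp (- (2 * L * (t - t0))) \<le> h\<^sup>2 / growth n n"
  proof -
    have "exp (- (2 * L * (t - t0))) = 1 / exp (2 * L * (t - t0))" by (simp only: exp_minus inverse_eq_divide)
    also have "\<dots> \<le> 1 / growth n n" using growth_le[OF assms(2)] gn by (intro divide_left_mono) auto
    finally have "h\<^sup>2 * exp (- (2 * L * (t - t0))) \<le> h\<^sup>2 * (1 / growth n n)" by (intro mult_left_mono) auto
    then show ?thesis by simp
  qed
  also have "\<dots> \<le> h\<^sup>2 / growth n n + \<nu>\<^sup>2 * step n * ?S"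
    using step_nonneg[of n] S by simp
  also have "\<dots> = 1 * (h\<^sup>2 / growth n n + \<nu>\<^sup>2 * step n * ?S)" by simp
  also have "\<dots> \<le> test_var n k"
    unfolding test_var_def using g gn step_nonneg[of n] S
    by (intro mult_right_mono add_nonneg_nonneg mult_nonneg_nonneg) auto
  finally show ?thesis .
qed

lemma test_var_pos: "k \<le> n \<Longrightarrow> 0 < n \<Longrightarrow> 0 < test_var n k"
  using test_var_lower[of k n] h_pos by (smt (verit) exp_gt_zero zero_less_power mult_pos_pos)

text \<open>
  With \<open>Q\<^sub>j = growth n j\<close>, the differences \<open>1/Q\<^sub>j - 1/Q\<^sub>j\<^sub>+\<^sub>1 = p\<^sub>j / Q\<^sub>j\<^sub>+\<^sub>1\<close> telescope. Since \<open>p\<^sub>j \<le> 2 L \<eta>\<close>, the noise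
  accumulated in \<open>test_var n 0\<close> is at least \<open>\<nu>\<^sup>2 / (2 L)\<close> times \<open>1 - 1/Q\<^sub>n\<close>.
\<close>

lemma initial_test_var_lower:
  assumes n: "0 < n"
  shows "\<nu>\<^sup>2 / (2 * L) * (growth n n - 1) \<le> test_var n 0 * growth n n"
proof -
  define G where "G = growth n n"
  have G: "1 \<le> G" unfolding G_def by (rule growth_ge_1) simp
  have "1 - 1 / G = (\<Sum>j<n. 1 / growth n j - 1 / growth n (Suc j))"
    using sum_lessThan_telescope'[of "\<lambda>j. 1 / growth n j" n] by (simp add: G_def)
  also have "\<dots> = (\<Sum>j<n. rate n j / growth n (Suc j))"
  proof (rule sum.cong)
    fix j assume "j \<in> {..<n}"
    then have "growth n j \<noteq> 0" "1 + rate n j \<noteq> 0" using growth_ge_1[of j n] rate_bounds[of j n] by force+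
    then show "1 / growth n j - 1 / growth n (Suc j) = rate n j / growth n (Suc j)"
      unfolding growth_Suc by (simp only: divide_simps) simp
  qed simp
  also have "\<dots> \<le> (\<Sum>j<n. 2 * L * step n * (1 / growth n (Suc j)))"
  proof (rule sum_mono)
    fix j assume "j \<in> {..<n}"
    then have "1 \<le> growth n (Suc j)" "rate n j \<le> 2 * L * step n"
      using growth_ge_1[of "Suc j" n] rate_bounds[of j n] by auto
    then show "rate n j / growth n (Suc j) \<le> 2 * L * step n * (1 / growth n (Suc j))"
      by (simp add: divide_right_mono)
  qed
  also have "\<dots> = 2 * L * step n * (\<Sum>j<n. 1 / growth n (Suc j))"
    by (simp add: sum_distrib_left)
  finally have *: "1 - 1 / G \<le> 2 * L * step n * (\<Sum>j<n. 1 / growth n (Suc j))" .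
  have "\<nu>\<^sup>2 / (2 * L) * (1 - 1 / G) \<le> \<nu>\<^sup>2 / (2 * L) * (2 * L * step n * (\<Sum>j<n. 1 / growth n (Suc j)))"
    using L_pos by (intro mult_left_mono *) auto
  also have "\<dots> = \<nu>\<^sup>2 * step n * (\<Sum>j<n. 1 / growth n (Suc j))" using L_pos by simp
  also have "\<dots> \<le> test_var n 0" using G by (simp add: test_var_def atLeast0LessThan G_def[symmetric])
  finally have "\<nu>\<^sup>2 / (2 * L) * (1 - 1 / G) * G \<le> test_var n 0 * G"
    using G by (intro mult_right_mono) auto
  moreover have "(1 - 1 / G) * G = G - 1" using G by (simp add: left_diff_distrib)
  ultimately show ?thesis unfolding G_def by (simp only: mult.assoc)
qed

text \<open>
  A product of factors \<open>1 + p\<close> is compared with the exponential of the sum up to an error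
  \<open>\<Sum>p\<^sup>2 = O(\<eta>)\<close>, so nothing is lost in the exponent as the time step tends to zero.
\<close>

lemma growth_lower:
  assumes n: "0 < n"
  shows "exp (2 * (step n * (\<Sum>k<n. lam (grid n k))) - (2 * L)\<^sup>2 * (t - t0) * step n) \<le> growth n n"
proof -
  have "2 * (step n * (\<Sum>k<n. lam (grid n k))) - (2 * L)\<^sup>2 * (t - t0) * step n
      = (\<Sum>k<n. rate n k - (2 * L * step n)\<^sup>2)"
    using step_total[OF n] by (simp add: rate_def sum_subtractf sum_distrib_left power2_eq_square mult_ac)
  also have "\<dots> \<le> (\<Sum>k<n. rate n k - (rate n k)\<^sup>2)"
    using rate_bounds by (intro sum_mono diff_left_mono power_mono) auto
  finally have "exp (2 * (step n * (\<Sum>k<n. lam (grid n k))) - (2 * L)\<^sup>2 * (t - t0) * step n)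
      \<le> exp (\<Sum>k<n. rate n k - (rate n k)\<^sup>2)" by simp
  also have "\<dots> = (\<Prod>k<n. exp (rate n k - (rate n k)\<^sup>2))" by (simp add: exp_sum)
  also have "\<dots> \<le> growth n n"
    unfolding growth_def using rate_bounds(1) by (intro prod_mono) (auto intro: exp_minus_square_le)
  finally show ?thesis .
qed

lemma Riemann_sum_tendsto:
  "(\<lambda>n. step n * (\<Sum>k<n. lam (grid n k))) \<longlonglongrightarrow> integral {t0..t} lam"
proof (rule LIMSEQ_I)
  fix e :: real assume e: "0 < e"
  define e' where "e' = e / (2 * (t - t0))"
  have e': "0 < e'" using e t0_less by (simp add: e'_def)
  obtain \<rho> where \<rho>: "0 < \<rho>" and cell: "\<And>u v. u \<le> v \<Longrightarrow> v - u < \<rho> \<Longrightarrow> {u..v} \<subseteq> {t0..t} \<Longrightarrow>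
      \<bar>integral {u..v} lam - (v - u) * lam u\<bar> \<le> e' * (v - u)"
    by (rule integral_near_left_endpoint_product[OF compact_Icc lam_cont e']) blast
  have "eventually (\<lambda>n. step n < \<rho>) sequentially"
    using step_tendsto \<rho> by (rule order_tendstoD)
  then obtain N where N: "\<And>n. n \<ge> N \<Longrightarrow> step n < \<rho>" by (auto simp: eventually_sequentially)
  show "\<exists>no. \<forall>n\<ge>no. norm (step n * (\<Sum>k<n. lam (grid n k)) - integral {t0..t} lam) < e"
  proof (intro exI allI impI)
    fix n assume "max N 1 \<le> n"
    then have n: "N \<le> n" "0 < n" by auto
    have split: "integral {t0..grid n k} lam = (\<Sum>j<k. integral {grid n j..grid n (Suc j)} lam)" if "k \<le> n" for k
      using that
    proof (induction k)
      case (Suc k)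
      have c: "continuous_on {t0..grid n (Suc k)} lam"
        using grid_le[of "Suc k" n] Suc.prems by (intro continuous_on_subset[OF lam_cont]) auto
      have "integral {t0..grid n k} lam + integral {grid n k..grid n (Suc k)} lam = integral {t0..grid n (Suc k)} lam"
        using grid_ge step_nonneg[of n] 
        by (intro Henstock_Kurzweil_Integration.integral_combine integrable_continuous_interval c)
          (auto simp: grid_Suc)
      then show ?case using Suc by simp
    qed simp
    have "integral {t0..t} lam - step n * (\<Sum>k<n. lam (grid n k))
        = (\<Sum>k<n. integral {grid n k..grid n (Suc k)} lam - step n * lam (grid n k))"
      using split[of n] grid_n[OF n(2)] by (simp add: sum_subtractf sum_distrib_left)
    also have "norm \<dots> \<le> (\<Sum>k<n. e' * step n)"
    proof (intro order_trans[OF norm_sum sum_mono])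
      fix k assume "k \<in> {..<n}"
      then have sub: "{grid n k..grid n (Suc k)} \<subseteq> {t0..t}"
        using grid_ge[of n k] grid_le[of "Suc k" n] by auto
      show "norm (integral {grid n k..grid n (Suc k)} lam - step n * lam (grid n k)) \<le> e' * step n"
        using cell[OF _ _ sub] N[OF n(1)] step_nonneg[of n] by (simp add: grid_Suc)
    qed
    also have "\<dots> = e' * (t - t0)" using step_total[OF n(2)] by (simp add: mult_ac)
    also have "\<dots> < e" using e t0_less unfolding e'_def by (simp add: field_simps)
    finally show "norm (step n * (\<Sum>k<n. lam (grid n k)) - integral {t0..t} lam) < e"
      by (subst norm_minus_commute)
  qed
qed

definition confined_gauss :: "nat \<Rightarrow> nat \<Rightarrow> real" where
  "confined_gauss n k = expectation (\<lambda>\<omega>. indicator (confined (grid n k)) \<omega> *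
     normal_density 0 (sqrt (test_var n k)) (X (grid n k) \<omega>))"

lemma normal_density_le_peak: "normal_density 0 (sqrt w) x \<le> 1 / sqrt (2 * pi * w)" if "0 < w"
  using that by (simp add: normal_density_def divide_right_mono)

lemma integrable_gauss:
  assumes "C \<in> events" "Y \<in> borel_measurable M" "0 < w"
  shows "integrable M (\<lambda>\<omega>. indicator C \<omega> * normal_density 0 (sqrt w) (Y \<omega>))"
proof (rule integrable_const_bound[where B = "1 / sqrt (2 * pi * w)"])
  show "AE \<omega> in M. norm (indicator C \<omega> * normal_density 0 (sqrt w) (Y \<omega>)) \<le> 1 / sqrt (2 * pi * w)"
    using normal_density_le_peak[OF assms(3)] assms(3) by (auto simp: indicator_def)
  show "(\<lambda>\<omega>. indicator C \<omega> * normal_density 0 (sqrt w) (Y \<omega>)) \<in> borel_measurable M"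
    using assms(1,2) by measurable
qed

text \<open>
  The only place where repulsion enters: \<open>(x + \<eta> g)\<^sup>2 \<ge> x\<^sup>2 + 2 \<eta> x g \<ge> (1 + 2 \<eta> lam) x\<^sup>2\<close>, and a centred
  Gaussian density decreases in \<open>\<bar>x\<bar>\<close>.
\<close>

lemma gauss_euler_le:
  assumes k: "k < n" and R: "(X (grid n k) \<omega>, grid n k) \<in> R"
  shows "normal_density 0 (sqrt (test_var n (Suc k) + \<nu>\<^sup>2 * step n)) (euler n k \<omega>)
    \<le> 1 / sqrt (1 + rate n k) * normal_density 0 (sqrt (test_var n k)) (X (grid n k) \<omega>)"
proof -
  let ?x = "X (grid n k) \<omega>" and ?s = "grid n k"
  let ?p = "1 + rate n k"
  have p: "1 \<le> ?p" using rate_bounds[OF k] by simp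
  have w: "0 < test_var n k" using k by (intro test_var_pos) auto
  have s: "?s \<in> {t0..t}" using k grid_ge grid_le[of k n] by auto
  have "?p * ?x\<^sup>2 \<le> (euler n k \<omega>)\<^sup>2"
  proof -
    have "?p * ?x\<^sup>2 = ?x\<^sup>2 + 2 * step n * (lam ?s * ?x\<^sup>2)" by (simp add: rate_def algebra_simps)
    also have "\<dots> \<le> ?x\<^sup>2 + 2 * step n * (?x * g ?x ?s)"
      using outward[OF R s] step_nonneg[of n] by (intro add_left_mono mult_left_mono) auto
    also have "\<dots> \<le> ?x\<^sup>2 + 2 * step n * (?x * g ?x ?s) + (step n * g ?x ?s)\<^sup>2" by simp
    also have "\<dots> = (euler n k \<omega>)\<^sup>2" using R by (simp add: euler_def drift_def power2_eq_square algebra_simps)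
    finally show ?thesis .
  qed
  have le: "?x\<^sup>2 / (2 * test_var n k) \<le> (euler n k \<omega>)\<^sup>2 / (2 * (?p * test_var n k))"
  proof -
    have "?x\<^sup>2 / (2 * test_var n k) = (?p * ?x\<^sup>2) / (2 * (?p * test_var n k))" using p w by simp
    also have "\<dots> \<le> (euler n k \<omega>)\<^sup>2 / (2 * (?p * test_var n k))"
      using \<open>?p * ?x\<^sup>2 \<le> (euler n k \<omega>)\<^sup>2\<close> p w by (intro divide_right_mono) auto
    finally show ?thesis .
  qed
  have "normal_density 0 (sqrt (test_var n (Suc k) + \<nu>\<^sup>2 * step n)) (euler n k \<omega>)
      = 1 / sqrt (2 * pi * (?p * test_var n k)) * exp (- ((euler n k \<omega>)\<^sup>2 / (2 * (?p * test_var n k))))"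
    unfolding normal_density_def test_var_step[OF k, symmetric] using p w by simp
  also have "\<dots> \<le> 1 / sqrt (2 * pi * (?p * test_var n k)) * exp (- (?x\<^sup>2 / (2 * test_var n k)))"
    using le p w by (intro mult_left_mono) auto
  also have "\<dots> = 1 / sqrt ?p * normal_density 0 (sqrt (test_var n k)) ?x"
    using p w by (simp add: normal_density_def real_sqrt_mult)
  finally show ?thesis .
qed

text \<open>
  One step of the discrete supermartingale. Replacing \<open>X\<close> at the end of the step by its Euler
  approximation costs the Lipschitz constant \<open>1/w\<close> times the error; afterwards the confinement is only
  required up to the beginning of the step, which makes it independent of the noise.
\<close>

lemma confined_gauss_Suc:
  assumes k: "k < n"
  shows "confined_gauss n (Suc k) \<le> 1 / sqrt (1 + rate n k) * confined_gauss n k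
    + expectation (euler_error n k) / test_var n (Suc k)"
proof -
  let ?s = "grid n k" and ?s' = "grid n (Suc k)" and ?w = "test_var n (Suc k)"
  let ?N = "\<lambda>v. normal_density 0 (sqrt v)"
  let ?Y = "\<lambda>\<omega>. euler n k \<omega> + noise n k \<omega>"
  have n: "0 < n" using k by simp
  have w: "0 < ?w" using k by (intro test_var_pos) auto
  have w0: "0 < test_var n k" using k by (intro test_var_pos) auto
  have v: "0 < ?w + \<nu>\<^sup>2 * step n" using w step_nonneg[of n] by (simp add: add_pos_nonneg)
  have ss': "?s < ?s'" using step_pos[OF n] by (simp add: grid_Suc)
  have C: "confined ?s \<in> events" "confined ?s' \<in> events"
    using k by (intro confined_event grid_ge grid_le; simp)+
  have E: "euler n k \<in> borel_measurable M" by (rule measurable_F[OF euler_adapted])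
  have Y: "?Y \<in> borel_measurable M" using E noise_measurable[of n k] by measurable
  have err: "integrable M (\<lambda>\<omega>. euler_error n k \<omega> / ?w)"
    using integrable_euler_error[OF k] by simp
  have "confined_gauss n (Suc k)
      \<le> expectation (\<lambda>\<omega>. indicator (confined ?s) \<omega> * ?N ?w (?Y \<omega>) + euler_error n k \<omega> / ?w)"
    unfolding confined_gauss_def
  proof (rule integral_mono)
    show "integrable M (\<lambda>\<omega>. indicator (confined ?s') \<omega> * ?N ?w (X ?s' \<omega>))"
      by (rule integrable_gauss[OF C(2) X_measurable w])
    show "integrable M (\<lambda>\<omega>. indicator (confined ?s) \<omega> * ?N ?w (?Y \<omega>) + euler_error n k \<omega> / ?w)"
      by (intro Bochner_Integration.integrable_add integrable_gauss C Y w err)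
    fix \<omega>
    show "indicator (confined ?s') \<omega> * ?N ?w (X ?s' \<omega>)
        \<le> indicator (confined ?s) \<omega> * ?N ?w (?Y \<omega>) + euler_error n k \<omega> / ?w"
    proof (cases "\<omega> \<in> confined ?s'")
      case True
      then have "\<omega> \<in> confined ?s" using confined_mono[of ?s ?s'] ss' by auto
      then show ?thesis
        using True normal_density_Lipschitz[OF w, of "X ?s' \<omega>" "?Y \<omega>"] by (simp add: euler_error_def)
    qed (simp add: euler_error_def)
  qed
  also have "\<dots> = expectation (\<lambda>\<omega>. indicator (confined ?s) \<omega> * ?N ?w (?Y \<omega>))
      + expectation (euler_error n k) / ?w"
    by (subst Bochner_Integration.integral_add) (auto intro!: integrable_gauss C Y w err)
  also have "expectation (\<lambda>\<omega>. indicator (confined ?s) \<omega> * ?N ?w (?Y \<omega>))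
      = expectation (\<lambda>\<omega>. indicator (confined ?s) \<omega> * ?N (?w + \<nu>\<^sup>2 * (?s' - ?s)) (euler n k \<omega>))"
    unfolding noise_def using t0_nonneg grid_ge[of n k] k
    by (intro expectation_normal_density_increment[OF wiener] ss' w \<nu>_pos euler_adapted
        confined_measurable grid_ge grid_le) auto
  also have "\<dots> = expectation (\<lambda>\<omega>. indicator (confined ?s) \<omega> * ?N (?w + \<nu>\<^sup>2 * step n) (euler n k \<omega>))"
    by (simp add: grid_Suc)
  also have "\<dots> \<le> expectation (\<lambda>\<omega>. 1 / sqrt (1 + rate n k) *
      (indicator (confined ?s) \<omega> * ?N (test_var n k) (X ?s \<omega>)))"
  proof (rule integral_mono)
    show "integrable M (\<lambda>\<omega>. indicator (confined ?s) \<omega> * ?N (?w + \<nu>\<^sup>2 * step n) (euler n k \<omega>))"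
      by (rule integrable_gauss[OF C(1) E v])
    show "integrable M (\<lambda>\<omega>. 1 / sqrt (1 + rate n k) * (indicator (confined ?s) \<omega> * ?N (test_var n k) (X ?s \<omega>)))"
      by (intro integrable_mult_right integrable_gauss C X_measurable w0)
    fix \<omega>
    show "indicator (confined ?s) \<omega> * ?N (?w + \<nu>\<^sup>2 * step n) (euler n k \<omega>)
        \<le> 1 / sqrt (1 + rate n k) * (indicator (confined ?s) \<omega> * ?N (test_var n k) (X ?s \<omega>))"
    proof (cases "\<omega> \<in> confined ?s")
      case True
      then have "(X ?s \<omega>, ?s) \<in> R" using grid_ge[of n k] by (auto simp: confined_def)
      then show ?thesis using True gauss_euler_le[OF k] by simp
    qed simp
  qed
  also have "\<dots> = 1 / sqrt (1 + rate n k) * confined_gauss n k"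
    unfolding confined_gauss_def by (rule integral_mult_right_zero)
  finally show ?thesis by simp
qed

text \<open>
  The errors of the single steps add up, because the factors \<open>1 / \<surd>(1 + p)\<close> by which they are multiplied in
  later steps are at most \<open>1\<close>.
\<close>

lemma confined_gauss_le:
  assumes n: "0 < n" and k: "k \<le> n"
  defines "c \<equiv> h\<^sup>2 * exp (- (2 * L * (t - t0)))"
  shows "confined_gauss n k \<le> confined_gauss n 0 / sqrt (growth n k) + (\<Sum>j<k. expectation (euler_error n j)) / c"
  using k
proof (induction k)
  case (Suc k)
  have c: "0 < c" using h_pos by (simp add: c_def)
  have err: "0 \<le> expectation (euler_error n j)" for j
    by (rule Bochner_Integration.integral_nonneg) (simp add: euler_error_def)
  have p: "1 \<le> sqrt (1 + rate n k)" using rate_bounds[of k n] Suc.prems by simp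
  let ?S = "(\<Sum>j<k. expectation (euler_error n j)) / c"
  have S: "0 \<le> ?S" using c by (intro divide_nonneg_pos sum_nonneg err)
  have IH: "confined_gauss n k \<le> confined_gauss n 0 / sqrt (growth n k) + ?S" using Suc by simp
  have "confined_gauss n (Suc k) \<le> 1 / sqrt (1 + rate n k) * confined_gauss n k
      + expectation (euler_error n k) / test_var n (Suc k)"
    using Suc.prems by (intro confined_gauss_Suc) simp
  also have "\<dots> \<le> 1 / sqrt (1 + rate n k) * (confined_gauss n 0 / sqrt (growth n k) + ?S)
      + expectation (euler_error n k) / c"
    using p IH err[of k] c test_var_lower[OF Suc.prems n]
    by (intro add_mono mult_left_mono divide_left_mono) (auto simp: c_def intro!: mult_pos_pos)
  also have "\<dots> = confined_gauss n 0 / sqrt (growth n (Suc k)) + ?S / sqrt (1 + rate n k)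
      + expectation (euler_error n k) / c"
    by (simp only: growth_Suc real_sqrt_mult) (simp add: distrib_left mult_ac)
  also have "?S / sqrt (1 + rate n k) \<le> ?S"
    using divide_left_mono[OF p S] p by simp
  finally show ?case by (simp add: add_divide_distrib)
qed simp

text \<open>
  At time \<open>t\<close> the test function is at least \<open>exp (-1/2) / (h \<surd>(2\<pi>))\<close> on the confined paths, since
  \<open>\<bar>X\<bar> \<le> h\<close> there; at time \<open>t0\<close> it is at most its peak \<open>1 / \<surd>(2\<pi> w\<^sub>0)\<close>.
\<close>

lemma prob_confined_discrete:
  assumes n: "0 < n" and G: "1 < growth n n"
  defines "c \<equiv> h\<^sup>2 * exp (- (2 * L * (t - t0)))"
  shows "prob (confined t) \<le> exp (1/2) * (h * sqrt (2 * L) / \<nu>) / sqrt (growth n n - 1)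
    + exp (1/2) * sqrt (2 * pi) * h / c * (\<Sum>j<n. expectation (euler_error n j))"
proof -
  let ?G = "growth n n" and ?p = "exp (- (1/2)) / (sqrt (2 * pi) * h)"
  let ?S = "\<Sum>j<n. expectation (euler_error n j)"
  have gt: "grid n n = t" by (rule grid_n[OF n])
  have Ct: "confined t \<in> events" using t0_less by (intro confined_event) auto
  have w0: "0 < test_var n 0" using n by (intro test_var_pos) auto
  have lower: "?p * prob (confined t) \<le> confined_gauss n n"
  proof -
    have "?p * prob (confined t) = expectation (\<lambda>\<omega>. ?p * indicator (confined t) \<omega>)"
      using Ct by simp
    also have "\<dots> \<le> confined_gauss n n"
      unfolding confined_gauss_def
    proof (rule integral_mono)
      show "integrable M (\<lambda>\<omega>. ?p * indicator (confined t) \<omega>)"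
        using Ct by (intro integrable_mult_right integrable_real_indicator) (auto simp: emeasure_eq_measure)
      show "integrable M (\<lambda>\<omega>. indicator (confined (grid n n)) \<omega> * normal_density 0 (sqrt (test_var n n)) (X (grid n n) \<omega>))"
        using Ct gt n by (intro integrable_gauss X_measurable test_var_pos) auto
      fix \<omega>
      show "?p * indicator (confined t) \<omega>
          \<le> indicator (confined (grid n n)) \<omega> * normal_density 0 (sqrt (test_var n n)) (X (grid n n) \<omega>)"
      proof (cases "\<omega> \<in> confined t")
        case True
        then have "(X t \<omega>, t) \<in> R" using t0_less by (auto simp: confined_def)
        then have "\<bar>X t \<omega>\<bar> \<le> h" by (rule final_width)
        then have "(X t \<omega>)\<^sup>2 \<le> h\<^sup>2" by (metis abs_ge_zero power2_abs power_mono)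
        then have "(X t \<omega>)\<^sup>2 / (2 * h\<^sup>2) \<le> 1/2" using h_pos by (simp add: field_simps)
        then show ?thesis using True h_pos
          by (simp add: gt test_var_final[OF n] normal_density_def real_sqrt_mult divide_right_mono)
      qed (simp add: gt)
    qed
    finally show ?thesis .
  qed
  have upper: "confined_gauss n 0 \<le> 1 / (sqrt (2 * pi) * sqrt (test_var n 0))"
  proof -
    have "confined_gauss n 0 \<le> expectation (\<lambda>\<omega>. 1 / sqrt (2 * pi * test_var n 0))"
      unfolding confined_gauss_def
    proof (rule integral_mono)
      show "integrable M (\<lambda>\<omega>. indicator (confined (grid n 0)) \<omega> * normal_density 0 (sqrt (test_var n 0)) (X (grid n 0) \<omega>))"
        using t0_less n by (intro integrable_gauss confined_event X_measurable test_var_pos) auto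
      fix \<omega>
      show "indicator (confined (grid n 0)) \<omega> * normal_density 0 (sqrt (test_var n 0)) (X (grid n 0) \<omega>)
          \<le> 1 / sqrt (2 * pi * test_var n 0)"
        using normal_density_le_peak[OF w0] w0 by (auto simp: indicator_def)
    qed simp
    then show ?thesis by (simp add: prob_space real_sqrt_mult)
  qed
  have step1: "1 / sqrt (test_var n 0 * ?G) \<le> sqrt (2 * L) / \<nu> / sqrt (?G - 1)"
  proof -
    have "\<nu> / sqrt (2 * L) * sqrt (?G - 1) = sqrt (\<nu>\<^sup>2 / (2 * L) * (?G - 1))"
      using \<nu>_pos by (simp add: real_sqrt_mult real_sqrt_divide)
    also have "\<dots> \<le> sqrt (test_var n 0 * ?G)"
      using initial_test_var_lower[OF n] by simp
    finally have "1 / sqrt (test_var n 0 * ?G) \<le> 1 / (\<nu> / sqrt (2 * L) * sqrt (?G - 1))"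
      using G \<nu>_pos L_pos w0 by (intro divide_left_mono) auto
    then show ?thesis by simp
  qed
  have "?p * prob (confined t) \<le> confined_gauss n 0 / sqrt ?G + ?S / c"
    using lower confined_gauss_le[OF n order_refl] unfolding c_def by linarith
  also have "\<dots> \<le> 1 / (sqrt (2 * pi) * sqrt (test_var n 0)) / sqrt ?G + ?S / c"
    using upper G by (intro add_right_mono divide_right_mono) auto
  also have "\<dots> = 1 / sqrt (2 * pi) * (1 / sqrt (test_var n 0 * ?G)) + ?S / c"
    by (simp add: real_sqrt_mult)
  also have "\<dots> \<le> 1 / sqrt (2 * pi) * (sqrt (2 * L) / \<nu> / sqrt (?G - 1)) + ?S / c"
    using step1 by (intro add_right_mono mult_left_mono) auto
  finally have main: "?p * prob (confined t) \<le> 1 / sqrt (2 * pi) * (sqrt (2 * L) / \<nu> / sqrt (?G - 1)) + ?S / c" .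
  define q where "q = exp (1/2 :: real) * sqrt (2 * pi) * h"
  have q: "0 < q" using h_pos by (simp add: q_def)
  have qp: "q * ?p = 1" using h_pos by (simp add: q_def exp_minus field_simps)
  have "prob (confined t) = q * (?p * prob (confined t))" by (simp only: mult.assoc[symmetric] qp mult_1)
  also have "\<dots> \<le> q * (1 / sqrt (2 * pi) * (sqrt (2 * L) / \<nu> / sqrt (?G - 1)) + ?S / c)"
    using main q by (intro mult_left_mono) auto
  also have "\<dots> = exp (1/2) * (h * sqrt (2 * L) / \<nu>) / sqrt (?G - 1) + q / c * ?S"
    by (simp add: q_def distrib_left)
  finally show ?thesis by (simp add: q_def)
qed

lemma integral_lam_pos: "0 < integral {t0..t} lam"
proof -
  obtain s where s: "s \<in> {t0..t}" "\<And>u. u \<in> {t0..t} \<Longrightarrow> lam s \<le> lam u"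
    using continuous_attains_inf[OF compact_Icc _ lam_cont] t0_less by force
  have "0 < (t - t0) * lam s" using lam_pos[OF s(1)] t0_less by simp
  also have "\<dots> = integral {t0..t} (\<lambda>_. lam s)" using t0_less by simp
  also have "\<dots> \<le> integral {t0..t} lam"
    by (intro integral_le integrable_const_ivl integrable_continuous_interval lam_cont s)
  finally show ?thesis .
qed

text \<open>
  The time step tends to zero. With \<open>v = \<nu>\<^sup>2/(2 L) (exp (2 q) - 1)\<close>, a lower bound for the variance at time \<open>t\<close>
  of the linear diffusion with drift \<open>lam(s) x\<close>, the bound is \<open>\<surd>e h/\<surd>v\<close>: up to a constant factor, the peak of
  a Gaussian density of variance \<open>v\<close> times the length of \<open>[-h, h]\<close>.
\<close>

theorem prob_confined_le:
  defines "q \<equiv> integral {t0..t} lam"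
  shows "prob (confined t) \<le> h * sqrt (2 * exp 1 * L) / \<nu> * (exp (- q) / sqrt (1 - exp (- 2 * q)))"
proof -
  let ?c = "h\<^sup>2 * exp (- (2 * L * (t - t0)))"
  let ?K = "exp (1/2) * (h * sqrt (2 * L) / \<nu>)"
  define \<theta> where "\<theta> n = 2 * (step n * (\<Sum>k<n. lam (grid n k))) - (2 * L)\<^sup>2 * (t - t0) * step n" for n
  let ?S = "\<lambda>n. \<Sum>j<n. expectation (euler_error n j)"
  have q: "0 < q" unfolding q_def by (rule integral_lam_pos)
  have \<theta>: "\<theta> \<longlonglongrightarrow> 2 * q"
  proof -
    have "\<theta> \<longlonglongrightarrow> 2 * q - (2 * L)\<^sup>2 * (t - t0) * 0"
      unfolding \<theta>_def q_def by (intro tendsto_intros Riemann_sum_tendsto step_tendsto)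
    then show ?thesis by simp
  qed
  have \<theta>_pos: "eventually (\<lambda>n. 0 < \<theta> n) sequentially"
    using \<theta> by (rule order_tendstoD(1)) (use q in simp)
  have "(\<lambda>n. ?K / sqrt (exp (\<theta> n) - 1) + exp (1/2) * sqrt (2 * pi) * h / ?c * ?S n)
      \<longlonglongrightarrow> ?K / sqrt (exp (2 * q) - 1) + exp (1/2) * sqrt (2 * pi) * h / ?c * 0"
    using q by (intro tendsto_intros \<theta> expected_euler_error_tendsto) auto
  moreover have "eventually (\<lambda>n. prob (confined t)
      \<le> ?K / sqrt (exp (\<theta> n) - 1) + exp (1/2) * sqrt (2 * pi) * h / ?c * ?S n) sequentially"
    using \<theta>_pos eventually_gt_at_top[of 0]
  proof eventually_elim
    fix n :: nat assume pos: "0 < \<theta> n" and n: "0 < n"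
    then have lo: "exp (\<theta> n) \<le> growth n n" using growth_lower[OF n] by (simp add: \<theta>_def)
    have gt: "1 < exp (\<theta> n)" using pos by simp
    have gr: "1 < growth n n" using gt lo by (rule less_le_trans)
    have "?K / sqrt (growth n n - 1) \<le> ?K / sqrt (exp (\<theta> n) - 1)"
      using lo gt gr h_pos L_pos \<nu>_pos by (intro divide_left_mono mult_pos_pos) auto
    then show "prob (confined t)
      \<le> ?K / sqrt (exp (\<theta> n) - 1) + exp (1/2) * sqrt (2 * pi) * h / ?c * ?S n"
      using prob_confined_discrete[OF n gr] by linarith
  qed
  ultimately have le: "prob (confined t) \<le> ?K / sqrt (exp (2 * q) - 1)"
    by (intro tendsto_lowerbound[of _ _ sequentially]) auto
  have sq: "sqrt (exp (2 * q) - 1) = exp q * sqrt (1 - exp (- 2 * q))"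
  proof -
    have "exp (2 * q) - 1 = (exp q)\<^sup>2 * (1 - exp (- 2 * q))"
      by (simp add: power2_eq_square exp_add[symmetric] algebra_simps)
    then show ?thesis by (simp add: real_sqrt_mult)
  qed
  have K: "?K = h * sqrt (2 * exp 1 * L) / \<nu>"
  proof -
    have "exp (1/2 :: real) = sqrt (exp 1)" by (rule real_sqrt_unique[symmetric]) (simp_all flip: exp_of_nat_mult)
    then show ?thesis by (simp add: real_sqrt_mult)
  qed
  show ?thesis
    using le unfolding sq K by (simp add: exp_minus[of q] divide_inverse mult_ac)
qed

end

section \<open>Width of the region in space\<close>

lemma C_bounded_cont:
  "C_bounded n d B g \<Longrightarrow> continuous_on ({-d..d} \<times> UNIV) (\<lambda>(x, t). g x t)"
  by (cases n) auto

lemma C_bounded_abs_le: "C_bounded n d B g \<Longrightarrow> x \<in> {-d..d} \<Longrightarrow> \<bar>g x t\<bar> \<le> B"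
  by (cases n) auto

lemma C_bounded_DERIV_x:
  assumes "C_bounded (Suc n) d B g" "x \<in> {-d..d}" "S \<subseteq> {-d..d}"
  shows "((\<lambda>y. g y t) has_field_derivative partial_x d g x t) (at x within S)"
proof -
  have "(\<lambda>y. g y t) differentiable (at x within {-d..d})" using assms by auto
  then have "((\<lambda>y. g y t) has_field_derivative partial_x d g x t) (at x within {-d..d})"
    by (simp add: partial_x_def has_real_derivative_iff_has_vector_derivative vector_derivative_works)
  then show ?thesis using assms(3) by (rule DERIV_subset)
qed

lemma C_bounded_DERIV_t:
  assumes "C_bounded (Suc n) d B g" "x \<in> {-d..d}"
  shows "(g x has_field_derivative partial_t g x t) (at t)"
proof -
  have "g x differentiable (at t)" using assms by auto
  then show ?thesis
    by (simp add: partial_t_def has_real_derivative_iff_has_vector_derivative vector_derivative_works)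
qed

text \<open>
  A mean value theorem with one-sided derivatives at the endpoints, as they arise from differentiation
  relative to \<open>[-d, d]\<close>.
\<close>

lemma DERIV_within_mvt:
  fixes u :: "real \<Rightarrow> real"
  assumes "x < y" "\<And>z. z \<in> {x..y} \<Longrightarrow> (u has_field_derivative u' z) (at z within {x..y})"
  obtains z where "z \<in> {x..y}" "u y - u x = (y - x) * u' z"
proof -
  have "\<exists>z\<in>{x..y}. u y - u x = (\<lambda>h. u' z * h) (y - x)"
    using assms by (intro mvt_very_simple) (auto simp: has_field_derivative_def)
  then show ?thesis using that by (auto simp: mult.commute)
qed

lemma DERIV_within_le_imp_le:
  fixes u v :: "real \<Rightarrow> real"
  assumes "\<And>z. z \<in> {0..c} \<Longrightarrow> (u has_field_derivative u' z) (at z within {0..c})"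
    and "\<And>z. z \<in> {0..c} \<Longrightarrow> (v has_field_derivative v' z) (at z within {0..c})"
    and le: "\<And>z. z \<in> {0..c} \<Longrightarrow> u' z \<le> v' z" and "u 0 \<le> v 0" and y: "y \<in> {0..c}"
  shows "u y \<le> v y"
proof (cases "y = 0")
  case False
  then have "0 < y" using y by simp
  moreover have "((\<lambda>z. v z - u z) has_field_derivative v' z - u' z) (at z within {0..y})" if "z \<in> {0..y}" for z
  proof -
    have "z \<in> {0..c}" using that y by auto
    then have "((\<lambda>z. v z - u z) has_field_derivative v' z - u' z) (at z within {0..c})"
      by (intro DERIV_diff assms)
    then show ?thesis by (rule DERIV_subset) (use y in auto)
  qed
  ultimately obtain z where z: "z \<in> {0..y}" "(v y - u y) - (v 0 - u 0) = (y - 0) * (v' z - u' z)"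
    by (rule DERIV_within_mvt)
  have "0 \<le> (y - 0) * (v' z - u' z)" using le[of z] z y by (intro mult_nonneg_nonneg) auto
  then show ?thesis using z(2) \<open>u 0 \<le> v 0\<close> by linarith
qed (use assms in simp)

lemma concave_through_origin_quotient_antimono:
  fixes u :: "real \<Rightarrow> real"
  assumes u: "\<And>z. z \<in> {0..c} \<Longrightarrow> (u has_field_derivative u' z) (at z within {0..c})"
    and u': "\<And>z. z \<in> {0..c} \<Longrightarrow> (u' has_field_derivative u'' z) (at z within {0..c})"
    and neg: "\<And>z. z \<in> {0..c} \<Longrightarrow> u'' z \<le> 0" and "u 0 = 0" and xy: "0 < x" "x \<le> y" "y \<le> c"
  shows "u y / y \<le> u x / x"
proof (cases "x = y")
  case False
  have du: "(u has_field_derivative u' z) (at z within {p..q})" if "0 \<le> p" "q \<le> c" "z \<in> {p..q}" for p q z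
    using that by (intro DERIV_subset[OF u]) auto
  have du': "(u' has_field_derivative u'' z) (at z within {p..q})" if "0 \<le> p" "q \<le> c" "z \<in> {p..q}" for p q z
    using that by (intro DERIV_subset[OF u']) auto
  obtain p where p: "p \<in> {0..x}" "u x - u 0 = (x - 0) * u' p"
    by (rule DERIV_within_mvt[of 0 x u u', OF xy(1) du]) (use xy in auto)
  have "x < y" using False xy by simp
  obtain q where q: "q \<in> {x..y}" "u y - u x = (y - x) * u' q"
    by (rule DERIV_within_mvt[of x y u u', OF \<open>x < y\<close> du]) (use xy in auto)
  have "u' q \<le> u' p"
  proof (cases "p = q")
    case False
    then have "p < q" using p q by auto
    obtain r where r: "r \<in> {p..q}" "u' q - u' p = (q - p) * u'' r"
      by (rule DERIV_within_mvt[of p q u' u'', OF \<open>p < q\<close> du']) (use xy p q in auto)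
    have "(q - p) * u'' r \<le> 0" using neg[of r] r p q xy by (intro mult_nonneg_nonpos) auto
    then show ?thesis using r by simp
  qed simp
  then have "(y - x) * u' q \<le> (y - x) * u' p" using xy by (intro mult_left_mono) auto
  then have "u y \<le> u x + (y - x) * u' p" using q(2) by linarith
  also have "\<dots> = y * u' p" using p \<open>u 0 = 0\<close> by (simp add: algebra_simps)
  finally show ?thesis using p \<open>u 0 = 0\<close> xy by (simp add: field_simps)
qed simp

context symmetric_drift
begin

abbreviation a :: "real \<Rightarrow> real" where "a \<equiv> partial_x d f 0"

abbreviation fxx :: "real \<Rightarrow> real \<Rightarrow> real" where "fxx \<equiv> partial_x d (partial_x d f)"

abbreviation fxxx :: "real \<Rightarrow> real \<Rightarrow> real" where "fxxx \<equiv> partial_x d fxx"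

lemma smooth_f: "C_bounded (Suc 3) d B f" using smooth by (simp add: eval_nat_numeral)

lemma smooth_fx: "C_bounded (Suc 2) d B (partial_x d f)" using smooth_f by (simp add: eval_nat_numeral)

lemma smooth_fxx: "C_bounded (Suc 1) d B fxx" using smooth_fx by (simp add: eval_nat_numeral)

lemma smooth_fxxx: "C_bounded (Suc 0) d B fxxx" using smooth_fxx by (simp add: eval_nat_numeral)

lemma zero_mem: "0 \<in> {-d..d}" using d_pos by simp

lemma B_nonneg: "0 \<le> B"
  using C_bounded_abs_le[OF smooth zero_mem, of 0] by linarith

lemma f_0: "f 0 t = 0" using zeros[OF zero_mem] by simp

lemma a_le_B: "a t \<le> B"
  using C_bounded_abs_le[OF smooth_fx zero_mem, of t] by linarith

lemma a_cont: "continuous_on S a"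
proof -
  have "continuous_on S (\<lambda>t. (\<lambda>(x, t). partial_x d f x t) (0, t))"
    using zero_mem by (intro continuous_on_compose2[OF C_bounded_cont[OF smooth_fx]] continuous_intros) auto
  then show ?thesis by simp
qed

text \<open>
  The third derivative is \<open>b\<close> at the origin and Lipschitz with constant \<open>B\<close> in both variables. The
  radius is chosen such that each variable accounts for at most a quarter of \<open>\<bar>b\<bar>\<close>; \<open>B + 1\<close> avoids a
  division by zero.
\<close>

lemma fxxx_le:
  assumes x: "x \<in> {0..d}" "x \<le> - b / (4 * (B + 1))" and t: "\<bar>t\<bar> \<le> - b / (4 * (B + 1))"
  shows "fxxx x t \<le> b / 2"
proof -
  have xd: "x \<in> {-d..d}" using x by auto
  have Cx: "C_bounded 0 d B (partial_x d fxxx)" and Ct: "C_bounded 0 d B (partial_t fxxx)"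
    using smooth_fxxx by simp_all
  have "norm (fxxx x t - fxxx 0 t) \<le> B * norm (x - 0)"
  proof (rule field_differentiable_bound[of "{-d..d}"])
    show "((\<lambda>y. fxxx y t) has_field_derivative partial_x d fxxx z t) (at z within {-d..d})"
      if "z \<in> {-d..d}" for z by (rule C_bounded_DERIV_x[OF smooth_fxxx that order_refl])
    show "norm (partial_x d fxxx z t) \<le> B" if "z \<in> {-d..d}" for z
      using C_bounded_abs_le[OF Cx that] by simp
  qed (use xd zero_mem in auto)
  moreover have "norm (fxxx 0 t - fxxx 0 0) \<le> B * norm (t - 0)"
  proof (rule field_differentiable_bound[OF convex_UNIV])
    show "(fxxx 0 has_field_derivative partial_t fxxx 0 s) (at s)" for s
      by (rule C_bounded_DERIV_t[OF smooth_fxxx zero_mem])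
    show "norm (partial_t fxxx 0 s) \<le> B" for s
      using C_bounded_abs_le[OF Ct zero_mem] by simp
  qed auto
  moreover have "fxxx 0 0 = b" using third_derivative by (simp add: eval_nat_numeral)
  ultimately have "fxxx x t \<le> b + B * x + B * \<bar>t\<bar>" using x by auto
  also have "\<dots> \<le> b + (B + 1) * (- b / (4 * (B + 1))) + (B + 1) * (- b / (4 * (B + 1)))"
    using x t B_nonneg by (intro add_mono mult_mono) auto
  also have "\<dots> = b / 2"
  proof -
    have quarter: "(B + 1) * (- b / (4 * (B + 1))) = - b / 4"
      using nonzero_mult_divide_mult_cancel_left[of "B + 1" "- b" 4] B_nonneg by (simp add: mult.commute)
    show ?thesis unfolding quarter by simp
  qed
  finally show ?thesis .
qed

text \<open>The concavity condition at \<open>x = 0\<close> itself is void; the sign passes over from \<open>x > 0\<close> by continuity.\<close>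

lemma fxx_0_le:
  assumes "0 < \<delta>" "\<delta> \<le> d" and conc: "\<And>x. \<bar>x\<bar> \<le> \<delta> \<Longrightarrow> x * fxx x t \<le> 0"
  shows "fxx 0 t \<le> 0"
proof -
  have "((\<lambda>x. fxx x t) has_field_derivative fxxx 0 t) (at 0 within {0..\<delta>})"
    using assms(1,2) by (intro C_bounded_DERIV_x[OF smooth_fxx]) auto
  then have "((\<lambda>x. fxx x t) \<longlongrightarrow> fxx 0 t) (at 0 within {0..\<delta>})"
    using DERIV_continuous continuous_within by blast
  then have lim: "((\<lambda>x. fxx x t) \<longlongrightarrow> fxx 0 t) (at_right 0)"
    using at_within_Icc_at_right[OF assms(1)] by simp
  have "eventually (\<lambda>x. fxx x t \<le> 0) (at_right 0)"
    using eventually_at_right_real[OF assms(1)]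
  proof eventually_elim
    fix x assume "x \<in> {0<..<\<delta>}"
    then show "fxx x t \<le> 0" using conc[of x] by (simp add: mult_le_0_iff)
  qed
  then show ?thesis by (intro tendsto_upperbound[OF lim]) auto
qed

text \<open>The bound on the third derivative is integrated three times from \<open>x = 0\<close>.\<close>

lemma f_le_cubic:
  assumes \<delta>: "0 < \<delta>" "\<delta> \<le> d" and conc: "\<And>x. \<bar>x\<bar> \<le> \<delta> \<Longrightarrow> x * fxx x t \<le> 0"
    and x: "0 \<le> x" "x \<le> \<delta>" "x \<le> - b / (4 * (B + 1))" and t: "\<bar>t\<bar> \<le> - b / (4 * (B + 1))"
  shows "f x t \<le> a t * x + b / 12 * x ^ 3"
proof -
  have sub: "{0..x} \<subseteq> {-d..d}" using \<delta> x by auto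
  have 2: "fxx y t \<le> b / 2 * y" if "y \<in> {0..x}" for y
  proof (rule DERIV_within_le_imp_le[where u = "\<lambda>y. fxx y t" and v = "\<lambda>y. b / 2 * y" and u' = "\<lambda>y. fxxx y t" and v' = "\<lambda>y. b / 2" and c = x])
    show "fxxx z t \<le> b / 2" if "z \<in> {0..x}" for z
      using that x \<delta> t by (intro fxxx_le) auto
    show "fxx 0 t \<le> b / 2 * 0" using fxx_0_le[OF \<delta> conc] by simp
    show "((\<lambda>y. fxx y t) has_field_derivative fxxx z t) (at z within {0..x})" if "z \<in> {0..x}" for z
      using that sub by (intro C_bounded_DERIV_x[OF smooth_fxx]) auto
  qed (use that in \<open>auto intro!: derivative_eq_intros\<close>)
  have 1: "partial_x d f y t \<le> a t + b / 4 * y\<^sup>2" if "y \<in> {0..x}" for y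
  proof (rule DERIV_within_le_imp_le[where u = "\<lambda>y. partial_x d f y t" and v = "\<lambda>y. a t + b / 4 * y\<^sup>2" and u' = "\<lambda>y. fxx y t" and v' = "\<lambda>y. b / 2 * y" and c = x])
    show "((\<lambda>y. partial_x d f y t) has_field_derivative fxx z t) (at z within {0..x})" if "z \<in> {0..x}" for z
      using that sub by (intro C_bounded_DERIV_x[OF smooth_fx]) auto
  qed (use that 2 in \<open>auto intro!: derivative_eq_intros\<close>)
  show ?thesis
  proof (rule DERIV_within_le_imp_le[where u = "\<lambda>y. f y t" and v = "\<lambda>y. a t * y + b / 12 * y ^ 3" and u' = "\<lambda>y. partial_x d f y t" and v' = "\<lambda>y. a t + b / 4 * y\<^sup>2" and c = x])
    show "((\<lambda>y. f y t) has_field_derivative partial_x d f z t) (at z within {0..x})" if "z \<in> {0..x}" for z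
      using that sub by (intro C_bounded_DERIV_x[OF smooth_f]) auto
  qed (use x 1 f_0 in \<open>auto intro!: derivative_eq_intros\<close>)
qed

text \<open>
  For \<open>\<bar>x\<bar>\<close> and \<open>t\<close> up to a constant radius \<open>\<rho>\<close>, the cubic bound turns \<open>f / x \<ge> \<kappa> a\<close> into
  \<open>x\<^sup>2 \<le> 12 a / \<bar>b\<bar>\<close>, which is of order \<open>t\<^sup>2\<close>. For larger \<open>\<bar>x\<bar>\<close> the quotient \<open>f / x\<close> decreases by concavity, so
  the condition holds at \<open>\<rho>\<close> too and forces \<open>t\<close> to be bounded below by a constant; then, as for
  \<open>t > \<rho>\<close>, the trivial bound \<open>\<bar>x\<bar> \<le> \<delta>\<close> is of order \<open>t\<close>.
\<close>

lemma width_le: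
  assumes \<delta>: "0 < \<delta>" "\<delta> \<le> d" and conc: "\<And>x. \<bar>x\<bar> \<le> \<delta> \<Longrightarrow> x * fxx x t \<le> 0"
    and \<kappa>: "0 < \<kappa>" and t: "0 < t" and C: "0 \<le> C" "a t \<le> C * t\<^sup>2"
    and x: "\<bar>x\<bar> \<le> \<delta>" "\<kappa> * a t * x\<^sup>2 \<le> x * f x t"
  defines "\<rho> \<equiv> - b / (4 * (B + 1))"
  shows "\<bar>x\<bar> \<le> (sqrt (12 * C / - b) * (1 + \<delta> / min \<rho> \<delta>) + \<delta> / \<rho>) * t"
proof -
  define H where "H = sqrt (12 * C / - b)"
  define y where "y = \<bar>x\<bar>"
  have \<rho>: "0 < \<rho>" using b_neg B_nonneg by (simp add: \<rho>_def field_simps)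
  have H: "0 \<le> H" using C b_neg by (simp add: H_def divide_nonneg_neg divide_nonpos_pos divide_nonneg_nonpos)
  have m: "0 < min \<rho> \<delta>" using \<rho> \<delta> by simp
  have y: "0 \<le> y" "y \<le> \<delta>" using x by (auto simp: y_def)
  \<comment> \<open>By oddness the condition is even in \<open>x\<close>, so only \<open>y = \<bar>x\<bar>\<close> matters.\<close>
  have "y * f y t = x * f x t"
    using odd[of x t] x \<delta> by (auto simp: y_def abs_if)
  then have Dy: "\<kappa> * a t * y\<^sup>2 \<le> y * f y t" using x by (simp add: y_def)
  have small: "z \<le> H * t" if z: "0 < z" "z \<le> \<delta>" "z \<le> \<rho>" "t \<le> \<rho>" and D: "\<kappa> * a t \<le> f z t / z" for z
  proof -
    have "f z t \<le> a t * z + b / 12 * z ^ 3"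
      using z t by (intro f_le_cubic[OF \<delta> conc]) (auto simp: \<rho>_def)
    then have "f z t / z \<le> (a t * z + b / 12 * z ^ 3) / z" using z by (intro divide_right_mono) auto
    also have "\<dots> = a t + b / 12 * z\<^sup>2" using z by (simp add: field_simps power2_eq_square power3_eq_cube)
    finally have "(- b / 12) * z\<^sup>2 \<le> a t" using D \<kappa> a_pos[of t] 
      by (smt (verit) mult_minus_left minus_divide_left mult_pos_pos)
    then have "z\<^sup>2 \<le> (12 * C / - b) * t\<^sup>2" using C b_neg by (simp add: field_simps)
    then have "sqrt (z\<^sup>2) \<le> sqrt ((12 * C / - b) * t\<^sup>2)" by (rule real_sqrt_le_mono)
    also have "sqrt ((12 * C / - b) * t\<^sup>2) = H * t"
      unfolding H_def real_sqrt_mult using \<open>0 < t\<close> by simp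
    finally show ?thesis using z by simp
  qed
  have "y \<le> H * t + H * (\<delta> / min \<rho> \<delta>) * t + \<delta> / \<rho> * t"
  proof -
    have nn: "0 \<le> H * t" "0 \<le> H * (\<delta> / min \<rho> \<delta>) * t" "0 \<le> \<delta> / \<rho> * t"
      using H t m \<delta> \<rho> by (auto intro!: mult_nonneg_nonneg divide_nonneg_pos)
    consider "y = 0" | "\<rho> < t" | "0 < y" "t \<le> \<rho>" "y \<le> \<rho>" | "0 < y" "t \<le> \<rho>" "\<rho> < y"
      using y by linarith
    then show ?thesis
    proof cases
      case 1
      then show ?thesis using nn by linarith
    next
      case 2
      have "y \<le> \<delta> / \<rho> * \<rho>" using y \<rho> by simp
      also have "\<dots> \<le> \<delta> / \<rho> * t" using 2 \<delta> \<rho> by (intro mult_left_mono) auto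
      finally show ?thesis using nn by linarith
    next
      case 3
      have "\<kappa> * a t \<le> f y t / y" using Dy 3 by (simp add: field_simps power2_eq_square)
      then have "y \<le> H * t" using small[of y] 3 y by simp
      then show ?thesis using nn by linarith
    next
      case 4
      have q: "f y t / y \<le> f \<rho> t / \<rho>"
      proof (rule concave_through_origin_quotient_antimono[where c = \<delta>
            and u = "\<lambda>x. f x t" and u' = "\<lambda>x. partial_x d f x t" and u'' = "\<lambda>x. fxx x t"])
        show "((\<lambda>x. f x t) has_field_derivative partial_x d f z t) (at z within {0..\<delta>})" if "z \<in> {0..\<delta>}" for z
          using that \<delta> by (intro C_bounded_DERIV_x[OF smooth_f]) auto
        show "((\<lambda>x. partial_x d f x t) has_field_derivative fxx z t) (at z within {0..\<delta>})" if "z \<in> {0..\<delta>}" for z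
          using that \<delta> by (intro C_bounded_DERIV_x[OF smooth_fx]) auto
        show "fxx z t \<le> 0" if "z \<in> {0..\<delta>}" for z
        proof (cases "z = 0")
          case True
          then show ?thesis using fxx_0_le[OF \<delta> conc] by simp
        next
          case False
          then show ?thesis using conc[of z] that by (simp add: mult_le_0_iff)
        qed
      qed (use f_0 \<rho> 4 y in auto)
      have "\<kappa> * a t \<le> f y t / y" using Dy 4 by (simp add: field_simps power2_eq_square)
      with q have "\<rho> \<le> H * t" using small[of \<rho>] 4 y \<rho> by simp
      then have "\<delta> / \<rho> * \<rho> \<le> \<delta> / \<rho> * (H * t)" using \<delta> \<rho> by (intro mult_left_mono) auto
      moreover have "min \<rho> \<delta> = \<rho>" using 4 y by simp
      ultimately have "y \<le> H * (\<delta> / min \<rho> \<delta>) * t" using y \<rho> by (simp add: mult_ac)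
      then show ?thesis using nn by linarith
    qed
  qed
  then show ?thesis unfolding H_def[symmetric] y_def[symmetric] by (simp add: algebra_simps)
qed

text \<open>Near \<open>0\<close> this is the expansion of \<open>a\<close>; away from \<open>0\<close> it holds because \<open>a \<le> B\<close>.\<close>

lemma a_le_quadratic:
  assumes "0 \<le> t" "a0 \<le> t\<^sup>2"
  shows "a t \<le> (1 + a1 + \<bar>K\<bar> * r + B / r\<^sup>2) * t\<^sup>2"
proof (cases "t \<le> r")
  case True
  have "a t \<le> a0 + a1 * t\<^sup>2 + K * t ^ 3" using a_expansion[of t] True assms by (simp add: abs_le_iff)
  also have "\<dots> \<le> t\<^sup>2 + a1 * t\<^sup>2 + \<bar>K\<bar> * r * t\<^sup>2"
  proof -
    have "K * t ^ 3 \<le> \<bar>K\<bar> * (t * t\<^sup>2)"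
      using assms by (simp add: power3_eq_cube power2_eq_square mult_right_mono mult.assoc)
    also have "\<dots> \<le> \<bar>K\<bar> * (r * t\<^sup>2)" using True by (intro mult_left_mono mult_right_mono) auto
    finally show ?thesis using assms by simp
  qed
  also have "\<dots> \<le> (1 + a1 + \<bar>K\<bar> * r + B / r\<^sup>2) * t\<^sup>2"
    using B_nonneg by (simp add: distrib_right)
  finally show ?thesis .
next
  case False
  have "a t \<le> B / r\<^sup>2 * r\<^sup>2" using a_le_B[of t] r_pos by simp
  also have "\<dots> \<le> B / r\<^sup>2 * t\<^sup>2" using False r_pos B_nonneg by (intro mult_left_mono power_mono) auto
  also have "\<dots> \<le> (1 + a1 + \<bar>K\<bar> * r + B / r\<^sup>2) * t\<^sup>2"
    using a1_pos r_pos by (intro mult_right_mono) auto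
  finally show ?thesis .
qed

end

section \<open>Late exit from the region\<close>

lemma before_exit_time:
  assumes "ereal t \<le> exit_time D t0 T x" "t0 \<le> s" "s < t" "t \<le> T"
  shows "(x s, s) \<in> D"
proof (rule ccontr)
  assume "(x s, s) \<notin> D"
  then have "exit_time D t0 T x \<le> ereal s"
    unfolding exit_time_def using assms by (intro Inf_lower) auto
  with assms(1) have "ereal t \<le> ereal s" by (rule order_trans)
  then show False using assms(3) by simp
qed

text \<open>
  Multiplying the defining inequality by \<open>x\<^sup>2\<close> gives a closed condition without a special case at \<open>x = 0\<close>.
\<close>

lemma D_region_imp:
  assumes "(x, s) \<in> D_region d g \<delta> T c1 \<sigma> \<kappa>"
  shows "\<bar>x\<bar> \<le> \<delta>" "\<kappa> * partial_x d g 0 s * x\<^sup>2 \<le> x * g x s"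
proof -
  show "\<bar>x\<bar> \<le> \<delta>" using assms by (auto simp: D_region_def)
  show "\<kappa> * partial_x d g 0 s * x\<^sup>2 \<le> x * g x s"
  proof (cases "x = 0")
    case False
    then have "\<kappa> * partial_x d g 0 s * x\<^sup>2 \<le> g x s / x * x\<^sup>2"
      using assms by (intro mult_right_mono) (auto simp: D_region_def)
    also have "\<dots> = x * g x s" using False by (simp add: power2_eq_square)
    finally show ?thesis .
  qed simp
qed

text \<open>
  The confinement bound has the exponent \<open>-q\<close> with \<open>q = \<kappa> \<alpha> / \<epsilon>\<close>, twice as good as the exponent
  \<open>-q/2\<close> of the final estimate.
\<close>

lemma exp_quotient_le:
  assumes "0 < (q::real)"
  shows "exp (- q) / sqrt (1 - exp (- 2 * q)) \<le> exp (- q / 2) / sqrt (1 - exp (- q))"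
  using assms by (intro frac_le) auto

context symmetric_drift
begin

lemma compact_outward_region:
  assumes "\<delta> \<le> d"
  shows "compact {(x, s). \<bar>x\<bar> \<le> \<delta> \<and> s \<in> {t0..t} \<and> \<kappa> * a s * x\<^sup>2 \<le> x * f x s}"
proof -
  let ?S = "{-\<delta>..\<delta>} \<times> {t0..t}"
  have "?S \<subseteq> {-d..d} \<times> UNIV" using assms by auto
  then have f: "continuous_on ?S (\<lambda>z. f (fst z) (snd z))"
    using continuous_on_subset[OF C_bounded_cont[OF smooth], of ?S] by (simp add: case_prod_unfold)
  have a: "continuous_on ?S (\<lambda>z. a (snd z))"
    by (rule continuous_on_compose2[OF a_cont[of UNIV]]) (auto intro!: continuous_intros)
  have "closed {z \<in> ?S. \<kappa> * a (snd z) * (fst z)\<^sup>2 \<le> fst z * f (fst z) (snd z)}"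
    by (intro continuous_on_closed_Collect_le continuous_intros f a closed_Times)
  moreover have "{z \<in> ?S. \<kappa> * a (snd z) * (fst z)\<^sup>2 \<le> fst z * f (fst z) (snd z)} \<subseteq> ?S" by auto
  moreover have "{z \<in> ?S. \<kappa> * a (snd z) * (fst z)\<^sup>2 \<le> fst z * f (fst z) (snd z)}
      = {(x, s). \<bar>x\<bar> \<le> \<delta> \<and> s \<in> {t0..t} \<and> \<kappa> * a s * x\<^sup>2 \<le> x * f x s}" by auto
  ultimately show ?thesis
    using bounded_subset[OF compact_imp_bounded[OF compact_Times[OF compact_Icc compact_Icc]]]
    by (metis (no_types, lifting) compact_eq_bounded_closed)
qed

text \<open>
  The confinement bound for the rescaled coefficients \<open>g = f/\<epsilon>\<close>, \<open>lam = \<kappa> a/\<epsilon>\<close>, \<open>\<nu> = \<sigma>/\<surd>\<epsilon>\<close>, with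
  \<open>L = \<kappa> C t\<^sup>2/\<epsilon>\<close> and \<open>h = H t\<close>. The powers of \<open>\<epsilon>\<close> cancel in \<open>h \<surd>L / \<nu>\<close>, which has order
  \<open>t\<^sup>2 / \<sigma> = (t / \<surd>\<sigma>)\<^sup>2\<close>.
\<close>

lemma prob_exit_late_le:
  fixes \<delta> \<kappa> C t2 t \<epsilon> \<sigma> c1 x2 :: real
  assumes \<delta>: "0 < \<delta>" "\<delta> \<le> d"
    and conc: "\<And>x. \<bar>x\<bar> \<le> \<delta> \<Longrightarrow> x * fxx x t \<le> 0"
    and \<kappa>: "0 < \<kappa>" and t: "0 \<le> t2" "t2 < t" "t \<le> T"
    and C: "0 < C" "\<And>s. s \<in> {t2..t} \<Longrightarrow> a s \<le> C * s\<^sup>2"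
    and \<epsilon>: "0 < \<epsilon>" and \<sigma>: "0 < \<sigma>"
    and W: "wiener_process M F W" and X: "sde_solution M F W f \<epsilon> \<sigma> t2 x2 X"
  defines "\<rho> \<equiv> - b / (4 * (B + 1))"
  defines "H \<equiv> sqrt (12 * C / - b) * (1 + \<delta> / min \<rho> \<delta>) + \<delta> / \<rho>"
  defines "\<alpha> \<equiv> LBINT u:{t2..t}. a u"
  shows "measure M {\<omega> \<in> space M. ereal t \<le> exit_time (D_region d f \<delta> T c1 \<sigma> \<kappa>) t2 T (\<lambda>s. X s \<omega>)}
    \<le> H * sqrt (2 * exp 1 * \<kappa> * C) * (t / sqrt \<sigma>)\<^sup>2 * exp (- (\<kappa> * \<alpha>) / (2 * \<epsilon>)) / sqrt (1 - exp (- (\<kappa> * \<alpha>) / \<epsilon>))"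
proof -
  define R where "R = {(x, s). \<bar>x\<bar> \<le> \<delta> \<and> s \<in> {t2..t} \<and> \<kappa> * a s * x\<^sup>2 \<le> x * f x s}"
  define g where "g x s = f x s / \<epsilon>" for x s
  define lam where "lam s = \<kappa> * a s / \<epsilon>" for s
  define \<nu> where "\<nu> = \<sigma> / sqrt \<epsilon>"
  have t_pos: "0 < t" using t by simp
  have \<rho>: "0 < \<rho>" using b_neg B_nonneg by (simp add: \<rho>_def field_simps)
  have H: "0 < H"
  proof -
    have "0 \<le> sqrt (12 * C / - b)" using C(1) b_neg by (simp add: divide_nonneg_nonpos)
    moreover have "0 < \<delta> / \<rho>" "0 \<le> 1 + \<delta> / min \<rho> \<delta>" using \<rho> \<delta> by (auto intro!: add_nonneg_nonneg)
    ultimately show ?thesis unfolding H_def by (intro add_nonneg_pos mult_nonneg_nonneg)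
  qed
  interpret S: confined_solution M F W X g lam R t2 t \<nu> "\<kappa> * C * t\<^sup>2 / \<epsilon>" "H * t"
  proof
    show "wiener_process M F W" by (rule W)
    show "X s \<in> borel_measurable (F s)" if "t2 \<le> s" for s using X that by (simp add: sde_solution_def)
    show "continuous_on {t2..} (\<lambda>s. X s \<omega>)" if "\<omega> \<in> space M" for \<omega>
      using X that by (simp add: sde_solution_def)
    have "AE \<omega> in M. \<forall>s\<ge>t2.
      X s \<omega> = x2 + (1 / \<epsilon>) * (LBINT u:{t2..s}. f (X u \<omega>) u) + \<nu> * (W s \<omega> - W t2 \<omega>)"
      using X unfolding sde_solution_def \<nu>_def by fast
    then show "AE \<omega> in M. \<forall>s\<ge>t2.
      X s \<omega> = X t2 \<omega> + (LBINT u:{t2..s}. g (X u \<omega>) u) + \<nu> * (W s \<omega> - W t2 \<omega>)"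
    proof eventually_elim
      fix \<omega>
      assume eq: "\<forall>s\<ge>t2. X s \<omega> = x2 + (1 / \<epsilon>) * (LBINT u:{t2..s}. f (X u \<omega>) u) + \<nu> * (W s \<omega> - W t2 \<omega>)"
      have "(LBINT u:{t2..t2}. f (X u \<omega>) u) = 0"
        unfolding set_lebesgue_integral_def
        by (rule integral_eq_zero_AE) (use AE_lborel_singleton[of t2] in eventually_elim, auto)
      then have "X t2 \<omega> = x2" using eq by simp
      moreover have "(LBINT u:{t2..s}. g (X u \<omega>) u) = (1 / \<epsilon>) * (LBINT u:{t2..s}. f (X u \<omega>) u)" for s
        by (simp add: g_def)
      ultimately show "\<forall>s\<ge>t2. X s \<omega> = X t2 \<omega> + (LBINT u:{t2..s}. g (X u \<omega>) u) + \<nu> * (W s \<omega> - W t2 \<omega>)"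
        using eq by simp
    qed
    show "compact R" unfolding R_def by (rule compact_outward_region[OF \<delta>(2)])
    show "continuous_on R (\<lambda>(x, s). g x s)"
    proof -
      have "continuous_on R (\<lambda>(x, s). f x s)"
        using \<delta> by (intro continuous_on_subset[OF C_bounded_cont[OF smooth]]) (auto simp: R_def)
      then show ?thesis unfolding g_def case_prod_unfold using \<epsilon> by (intro continuous_intros) auto
    qed
    show "continuous_on {t2..t} lam"
      unfolding lam_def using \<epsilon> by (intro continuous_intros a_cont) auto
    show "0 < lam s" for s using a_pos[of s] \<kappa> \<epsilon> by (simp add: lam_def)
    show "lam s \<le> \<kappa> * C * t\<^sup>2 / \<epsilon>" if s: "s \<in> {t2..t}" for s
    proof -
      have "a s \<le> C * t\<^sup>2" using C(2)[OF s] s t C(1)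
        by (elim order_trans) (intro mult_left_mono power_mono; simp)
      then show ?thesis using \<kappa> \<epsilon> unfolding lam_def
        by (intro divide_right_mono) (simp_all add: mult.assoc mult_left_mono)
    qed
    show "lam s * x\<^sup>2 \<le> x * g x s" if "(x, s) \<in> R" for x s
      using divide_right_mono[of "\<kappa> * a s * x\<^sup>2" "x * f x s" \<epsilon>] that \<epsilon> by (simp add: R_def lam_def g_def)
    show "\<bar>x\<bar> \<le> H * t" if "(x, t) \<in> R" for x
      unfolding H_def \<rho>_def using that C t t_pos by (intro width_le[OF \<delta> conc \<kappa>]) (auto simp: R_def)
    show "0 < H * t" using H t_pos by simp
    show "0 < \<nu>" using \<epsilon> \<sigma> by (simp add: \<nu>_def)
  qed (use t in auto)
  define q where "q = integral {t2..t} lam"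
  have \<alpha>: "\<alpha> = integral {t2..t} a"
    unfolding \<alpha>_def by (intro set_borel_integral_eq_integral(2) borel_integrable_atLeastAtMost' a_cont)
  have q: "q = \<kappa> * \<alpha> / \<epsilon>"
    unfolding q_def lam_def \<alpha> by simp
  have "{\<omega> \<in> space M. ereal t \<le> exit_time (D_region d f \<delta> T c1 \<sigma> \<kappa>) t2 T (\<lambda>s. X s \<omega>)} \<subseteq> S.confined t"
  proof
    fix \<omega> assume "\<omega> \<in> {\<omega> \<in> space M. ereal t \<le> exit_time (D_region d f \<delta> T c1 \<sigma> \<kappa>) t2 T (\<lambda>s. X s \<omega>)}"
    then have \<omega>: "\<omega> \<in> space M" and late: "ereal t \<le> exit_time (D_region d f \<delta> T c1 \<sigma> \<kappa>) t2 T (\<lambda>s. X s \<omega>)"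
      by auto
    show "\<omega> \<in> S.confined t"
    proof (rule S.confined_if_before[OF \<omega>])
      fix s assume s: "t2 \<le> s" "s < t"
      then have "(X s \<omega>, s) \<in> D_region d f \<delta> T c1 \<sigma> \<kappa>"
        using before_exit_time[OF late] t(3) by blast
      then show "(X s \<omega>, s) \<in> R"
        using D_region_imp[of "X s \<omega>" s] s by (simp add: R_def)
    qed
  qed
  then have "measure M {\<omega> \<in> space M. ereal t \<le> exit_time (D_region d f \<delta> T c1 \<sigma> \<kappa>) t2 T (\<lambda>s. X s \<omega>)}
      \<le> measure M (S.confined t)"
    using t by (intro S.finite_measure_mono S.confined_event) auto
  also have "\<dots> \<le> H * t * sqrt (2 * exp 1 * (\<kappa> * C * t\<^sup>2 / \<epsilon>)) / \<nu> * (exp (- q) / sqrt (1 - exp (- 2 * q)))"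
    unfolding q_def by (rule S.prob_confined_le)
  also have "H * t * sqrt (2 * exp 1 * (\<kappa> * C * t\<^sup>2 / \<epsilon>)) / \<nu> = H * sqrt (2 * exp 1 * \<kappa> * C) * (t / sqrt \<sigma>)\<^sup>2"
  proof -
    have "2 * exp 1 * (\<kappa> * C * t\<^sup>2 / \<epsilon>) = (2 * exp 1 * \<kappa> * C) * t\<^sup>2 / \<epsilon>" by simp
    then have "sqrt (2 * exp 1 * (\<kappa> * C * t\<^sup>2 / \<epsilon>)) = sqrt (2 * exp 1 * \<kappa> * C) * t / sqrt \<epsilon>"
      using t_pos by (simp only: real_sqrt_mult real_sqrt_divide) simp
    moreover have "(t / sqrt \<sigma>)\<^sup>2 = t\<^sup>2 / \<sigma>" using \<sigma> by (simp add: power_divide)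
    ultimately show ?thesis using \<epsilon> \<sigma> by (simp add: \<nu>_def power2_eq_square)
  qed
  also have "\<dots> * (exp (- q) / sqrt (1 - exp (- 2 * q))) \<le> \<dots> * (exp (- q / 2) / sqrt (1 - exp (- q)))"
  proof (intro mult_left_mono exp_quotient_le)
    show "0 < q" unfolding q_def by (rule S.integral_lam_pos)
    show "0 \<le> H * sqrt (2 * exp 1 * \<kappa> * C) * (t / sqrt \<sigma>)\<^sup>2" using H \<kappa> C(1) by simp
  qed
  finally show ?thesis by (simp add: q mult.commute)
qed

end

theorem theorem2p4:
  fixes f :: "real \<Rightarrow> real \<Rightarrow> real \<Rightarrow> real"
    and xstar :: "real \<Rightarrow> real \<Rightarrow> real"
    and A d T a1 b B K r m \<delta> c1 \<kappa> :: real
  assumes "0 < A"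
    and "\<And>a0. a0 \<in> {0<..A} \<Longrightarrow> symmetric_drift d T a1 b B K r m a0 (f a0) (xstar a0)"
    and "\<And>a0. a0 \<in> {0<..A} \<Longrightarrow> sde_conditions (f a0)"
    and "0 < \<delta>" and "\<delta> \<le> d"
    and "\<And>a0 x t. a0 \<in> {0<..A} \<Longrightarrow> \<bar>x\<bar> \<le> \<delta> \<Longrightarrow> \<bar>t\<bar> \<le> T \<Longrightarrow>
           x * (partial_x d ^^ 2) (f a0) x t \<le> 0"
    and "0 < c1" and "0 < \<kappa>" and "\<kappa> < 1"
  shows "\<exists>c2 C0 :: real. c1 \<le> c2 \<and> 0 < C0 \<and>
    (\<forall>a0 \<sigma> :: real \<Rightarrow> real.
      (\<forall>\<epsilon>>0. 0 < a0 \<epsilon> \<and> 0 < \<sigma> \<epsilon>) \<longrightarrow> (a0 \<longlongrightarrow> 0) (at_right 0) \<longrightarrow>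
      (\<forall>\<^sub>F \<epsilon> in at_right 0.
        c1\<^sup>2 * \<sigma> \<epsilon> \<ge> max (a0 \<epsilon>) (\<epsilon> powr (2/3)) \<longrightarrow>
        (\<forall>(M :: 'w measure) F W X x2 t2 t.
          wiener_process M F W \<longrightarrow>
          sde_solution M F W (f (a0 \<epsilon>)) \<epsilon> (\<sigma> \<epsilon>) t2 x2 X \<longrightarrow>
          (x2, t2) \<in> D_region d (f (a0 \<epsilon>)) \<delta> T c1 (\<sigma> \<epsilon>) \<kappa> \<longrightarrow>
          t2 \<ge> c2 * sqrt (\<sigma> \<epsilon>) \<longrightarrow> t \<in> {t2<..T} \<longrightarrow>
          (let \<alpha> = LBINT u:{t2..t}. partial_x d (f (a0 \<epsilon>)) 0 u in
            measure M {\<omega> \<in> space M.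
                exit_time (D_region d (f (a0 \<epsilon>)) \<delta> T c1 (\<sigma> \<epsilon>) \<kappa>) t2 T (\<lambda>s. X s \<omega>) \<ge> ereal t}
              \<le> C0 * (t / sqrt (\<sigma> \<epsilon>))\<^sup>2 * exp (- (\<kappa> * \<alpha>) / (2 * \<epsilon>))
                  / sqrt (1 - exp (- (\<kappa> * \<alpha>) / \<epsilon>))))))"
proof -
  \<comment> \<open>\<open>C\<close> bounds \<open>a(t) / t\<^sup>2\<close>, \<open>\<rho>\<close> is the radius of validity of the cubic bound on \<open>f\<close>, and \<open>H t\<close> is the
    half-width of the region at time \<open>t\<close>.\<close>
  define C where "C = 1 + a1 + \<bar>K\<bar> * r + B / r\<^sup>2"
  define \<rho> where "\<rho> = - b / (4 * (B + 1))"
  define H where "H = sqrt (12 * C / - b) * (1 + \<delta> / min \<rho> \<delta>) + \<delta> / \<rho>"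
  define C0 where "C0 = H * sqrt (2 * exp 1 * \<kappa> * C)"
  interpret A: symmetric_drift d T a1 b B K r m A "f A" "xstar A"
    using assms(1,2) by simp
  have C: "0 < C" unfolding C_def using A.a1_pos A.r_pos A.B_nonneg by (simp add: add_pos_nonneg)
  have \<rho>: "0 < \<rho>" using A.b_neg A.B_nonneg by (simp add: \<rho>_def field_simps)
  have "0 \<le> sqrt (12 * C / - b)" using C A.b_neg by (simp add: divide_nonneg_nonpos)
  moreover have "0 < \<delta> / \<rho>" "0 \<le> 1 + \<delta> / min \<rho> \<delta>" using \<rho> \<open>0 < \<delta>\<close> by (auto intro!: add_nonneg_nonneg)
  ultimately have "0 < H" unfolding H_def by (intro add_nonneg_pos mult_nonneg_nonneg)
  then have C0: "0 < C0" unfolding C0_def using C \<open>0 < \<kappa>\<close> by simp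
  show ?thesis
  proof (rule exI[of _ c1], rule exI[of _ C0], intro conjI order_refl C0 allI impI)
    fix a0 \<sigma> :: "real \<Rightarrow> real"
    assume pos: "\<forall>\<epsilon>>0. 0 < a0 \<epsilon> \<and> 0 < \<sigma> \<epsilon>" and lim: "(a0 \<longlongrightarrow> 0) (at_right 0)"
    have "eventually (\<lambda>\<epsilon>. a0 \<epsilon> < A) (at_right 0)" using lim \<open>0 < A\<close> by (rule order_tendstoD(2))
    with eventually_at_right_less[of "0 :: real"]
    show "\<forall>\<^sub>F \<epsilon> in at_right 0.
        c1\<^sup>2 * \<sigma> \<epsilon> \<ge> max (a0 \<epsilon>) (\<epsilon> powr (2/3)) \<longrightarrow>
        (\<forall>(M :: 'w measure) F W X x2 t2 t.
          wiener_process M F W \<longrightarrow>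
          sde_solution M F W (f (a0 \<epsilon>)) \<epsilon> (\<sigma> \<epsilon>) t2 x2 X \<longrightarrow>
          (x2, t2) \<in> D_region d (f (a0 \<epsilon>)) \<delta> T c1 (\<sigma> \<epsilon>) \<kappa> \<longrightarrow>
          t2 \<ge> c1 * sqrt (\<sigma> \<epsilon>) \<longrightarrow> t \<in> {t2<..T} \<longrightarrow>
          (let \<alpha> = LBINT u:{t2..t}. partial_x d (f (a0 \<epsilon>)) 0 u in
            measure M {\<omega> \<in> space M.
                exit_time (D_region d (f (a0 \<epsilon>)) \<delta> T c1 (\<sigma> \<epsilon>) \<kappa>) t2 T (\<lambda>s. X s \<omega>) \<ge> ereal t}
              \<le> C0 * (t / sqrt (\<sigma> \<epsilon>))\<^sup>2 * exp (- (\<kappa> * \<alpha>) / (2 * \<epsilon>))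
                  / sqrt (1 - exp (- (\<kappa> * \<alpha>) / \<epsilon>))))"
    proof (eventually_elim, intro impI allI)
      fix \<epsilon> and M :: "'w measure" and F W X x2 t2 t
      assume \<epsilon>: "0 < \<epsilon>" and a0A: "a0 \<epsilon> < A"
        and big: "c1\<^sup>2 * \<sigma> \<epsilon> \<ge> max (a0 \<epsilon>) (\<epsilon> powr (2/3))"
        and W: "wiener_process M F W" and X: "sde_solution M F W (f (a0 \<epsilon>)) \<epsilon> (\<sigma> \<epsilon>) t2 x2 X"
        and t2: "t2 \<ge> c1 * sqrt (\<sigma> \<epsilon>)" and t: "t \<in> {t2<..T}"
      have a0: "a0 \<epsilon> \<in> {0<..A}" and \<sigma>: "0 < \<sigma> \<epsilon>" using pos \<epsilon> a0A by auto
      interpret D: symmetric_drift d T a1 b B K r m "a0 \<epsilon>" "f (a0 \<epsilon>)" "xstar (a0 \<epsilon>)"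
        by (rule assms(2)[OF a0])
      have t2_pos: "0 < t2" using t2 \<open>0 < c1\<close> \<sigma> by (smt (verit) mult_pos_pos real_sqrt_gt_0_iff)
      have quad: "D.a s \<le> C * s\<^sup>2" if s: "s \<in> {t2..t}" for s
        unfolding C_def
      proof (rule D.a_le_quadratic)
        show "0 \<le> s" using s t2_pos by simp
        have "a0 \<epsilon> \<le> (c1 * sqrt (\<sigma> \<epsilon>))\<^sup>2" using big \<sigma> by (simp add: power_mult_distrib)
        also have "\<dots> \<le> s\<^sup>2" using s t2 \<open>0 < c1\<close> \<sigma> by (intro power_mono) auto
        finally show "a0 \<epsilon> \<le> s\<^sup>2" .
      qed
      have conc: "x * D.fxx x t \<le> 0" if "\<bar>x\<bar> \<le> \<delta>" for x
        using assms(6)[OF a0 that, of t] t t2_pos by (simp add: eval_nat_numeral)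
      show "let \<alpha> = LBINT u:{t2..t}. partial_x d (f (a0 \<epsilon>)) 0 u in
            measure M {\<omega> \<in> space M.
                exit_time (D_region d (f (a0 \<epsilon>)) \<delta> T c1 (\<sigma> \<epsilon>) \<kappa>) t2 T (\<lambda>s. X s \<omega>) \<ge> ereal t}
              \<le> C0 * (t / sqrt (\<sigma> \<epsilon>))\<^sup>2 * exp (- (\<kappa> * \<alpha>) / (2 * \<epsilon>))
                  / sqrt (1 - exp (- (\<kappa> * \<alpha>) / \<epsilon>))"
        unfolding Let_def C0_def H_def \<rho>_def
        using t t2_pos
        by (intro D.prob_exit_late_le[OF \<open>0 < \<delta>\<close> \<open>\<delta> \<le> d\<close> conc \<open>0 < \<kappa>\<close> _ _ _ C quad \<epsilon> \<sigma> W X]) auto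
    qed
  qed
qed

end
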